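(* Let $n\ge 3$ be an odd number. Then there exists $\delta>0$ such that for every integer $N\ge n$ there exists a continuous family $\{B_V\}_{V\in G(n,N)}$, where each $B_V$ is a symmetric convex body in the $n$-dimensional linear subspace $V\subset\mathbf{R}^N$, such that for every $V\in G(n,N)$ and every $n$-dimensional Euclidean ball $D\subset V$ containing the origin in its interior one has $d(B_V,D)>\delta$.
   Context: $G(n,N)$ is the Grassmannian of (unoriented) $n$-dimensional linear subspaces of $\mathbf{R}^N$; each subspace carries the Euclidean structure induced from $\mathbf{R}^N$. A convex body in $V$ is a compact convex subset of $V$ with nonempty interior in $V$; it is symmetric if it is invariant under $x\mapsto -x$. A family $\{B_V\}$ of nonempty compact convex sets $B_V\subset V$ is continuous if $B_V$ depends continuously on $V$ in the Hausdorff metric (equivalently, the support function $h_{B_V}(v)=\sup\{\langle v,x\rangle: x\in B_V\}$ is continuous in the pair $(V,v)$, $v$ a unit vector of $V$). For two convex bodies $B_1,B_2$ in an $n$-dimensional space containing the origin in their interiors, $$d(B_1,B_2)=\inf\{\log(t/s)\;:\; s,t>0,\ sB_1\subseteq B_2\subseteq tB_1\},$$ where $sB$ is the image of $B$ under the homothety $x\mapsto sx$. *)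

theory Defs
  imports "HOL-Analysis.Analysis" "HOL-Library.Poly_Mapping"
begin

text \<open>
  The dimension \<open>N\<close> of the ambient space is quantified inside the theorem, after a constant that
  must not depend on it, so the spaces \<open>\<real>\<^sup>N\<close> have to live in one type. They are realised as the
  coordinate subspaces of the space \<^typ>\<open>nat \<Rightarrow>\<^sub>0 real\<close> of finitely supported sequences with its
  standard inner product.
\<close>

instantiation poly_mapping :: (type, real_vector) real_vector
begin

lift_definition scaleR_poly_mapping :: "real \<Rightarrow> ('a \<Rightarrow>\<^sub>0 'b) \<Rightarrow> ('a \<Rightarrow>\<^sub>0 'b)"
  is "\<lambda>r f k. r *\<^sub>R f k"
  by (rule finite_subset[rotated]) auto

instance
  by intro_classes (transfer; simp add: fun_eq_iff scaleR_add_right scaleR_add_left)+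

end

lemma lookup_scaleR [simp]:
  "Poly_Mapping.lookup (r *\<^sub>R x) k = r *\<^sub>R Poly_Mapping.lookup x k"
  by transfer simp

instantiation poly_mapping :: (type, real_inner) real_inner
begin

definition inner_poly_mapping :: "('a \<Rightarrow>\<^sub>0 'b) \<Rightarrow> ('a \<Rightarrow>\<^sub>0 'b) \<Rightarrow> real" where
  "inner_poly_mapping x y =
     (\<Sum>k\<in>Poly_Mapping.keys x. Poly_Mapping.lookup x k \<bullet> Poly_Mapping.lookup y k)"

definition norm_poly_mapping :: "('a \<Rightarrow>\<^sub>0 'b) \<Rightarrow> real" where
  "norm_poly_mapping x = sqrt (x \<bullet> x)"

definition sgn_poly_mapping :: "('a \<Rightarrow>\<^sub>0 'b) \<Rightarrow> ('a \<Rightarrow>\<^sub>0 'b)" where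
  "sgn_poly_mapping x = inverse (norm x) *\<^sub>R x"

definition dist_poly_mapping :: "('a \<Rightarrow>\<^sub>0 'b) \<Rightarrow> ('a \<Rightarrow>\<^sub>0 'b) \<Rightarrow> real" where
  "dist_poly_mapping x y = norm (x - y)"

definition uniformity_poly_mapping :: "(('a \<Rightarrow>\<^sub>0 'b) \<times> ('a \<Rightarrow>\<^sub>0 'b)) filter" where
  "uniformity_poly_mapping = (INF e\<in>{0<..}. principal {(x, y). dist x y < e})"

definition open_poly_mapping :: "('a \<Rightarrow>\<^sub>0 'b) set \<Rightarrow> bool" where
  "open_poly_mapping U \<longleftrightarrow> (\<forall>x\<in>U. eventually (\<lambda>(x', y). x' = x \<longrightarrow> y \<in> U) uniformity)"

lemma inner_poly_mapping_superset:
  fixes x y :: "'a \<Rightarrow>\<^sub>0 'b"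
  assumes "finite S" "Poly_Mapping.keys x \<subseteq> S"
  shows "x \<bullet> y = (\<Sum>k\<in>S. Poly_Mapping.lookup x k \<bullet> Poly_Mapping.lookup y k)"
  unfolding inner_poly_mapping_def
  by (rule sum.mono_neutral_left) (use assms in \<open>auto simp: in_keys_iff\<close>)

instance
proof
  fix x y z :: "'a \<Rightarrow>\<^sub>0 'b" and r :: real
  let ?S = "Poly_Mapping.keys x \<union> Poly_Mapping.keys y \<union> Poly_Mapping.keys z"
  note S = inner_poly_mapping_superset[of ?S]
  show "x \<bullet> y = y \<bullet> x"
    by (simp add: S inner_commute Un_assoc le_supI1 le_supI2)
  show "(x + y) \<bullet> z = x \<bullet> z + y \<bullet> z"
  proof -
    have "Poly_Mapping.keys (x + y) \<subseteq> ?S"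
      using Poly_Mapping.keys_add[of x y] by blast
    then show ?thesis
      by (simp add: S le_supI1 lookup_add inner_add_left sum.distrib)
  qed
  show "(r *\<^sub>R x) \<bullet> y = r * (x \<bullet> y)"
  proof -
    have "Poly_Mapping.keys (r *\<^sub>R x) \<subseteq> ?S"
      by (auto simp: in_keys_iff)
    then show ?thesis
      by (simp add: S le_supI1 sum_distrib_left)
  qed
  show "0 \<le> x \<bullet> x"
    by (simp add: inner_poly_mapping_def sum_nonneg)
  show "x \<bullet> x = 0 \<longleftrightarrow> x = 0"
  proof
    assume "x \<bullet> x = 0"
    then have "\<forall>k\<in>Poly_Mapping.keys x. Poly_Mapping.lookup x k = 0"
      by (simp add: inner_poly_mapping_def sum_nonneg_eq_0_iff)
    then show "x = 0"
      by (metis in_keys_iff keys_eq_empty ex_in_conv)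
  qed (simp add: inner_poly_mapping_def)
qed (rule norm_poly_mapping_def sgn_poly_mapping_def dist_poly_mapping_def
       uniformity_poly_mapping_def open_poly_mapping_def)+

end

type_synonym seq = "nat \<Rightarrow>\<^sub>0 real"

definition Rn :: "nat \<Rightarrow> seq set" where
  "Rn N = {x. Poly_Mapping.keys x \<subseteq> {..<N}}"

lemma inner_Rn:
  assumes "x \<in> Rn N"
  shows "x \<bullet> y = (\<Sum>i<N. Poly_Mapping.lookup x i * Poly_Mapping.lookup y i)"
  using assms by (simp add: Rn_def inner_poly_mapping_superset[of "{..<N}"])

lemma lookup_image_Rn: "Poly_Mapping.lookup ` Rn N = {f. \<forall>i\<ge>N. f i = 0}"
proof (intro set_eqI iffI)
  fix f :: "nat \<Rightarrow> real" assume f: "f \<in> {f. \<forall>i\<ge>N. f i = 0}"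
  then have sub: "{i. f i \<noteq> 0} \<subseteq> {..<N}" using not_le by auto
  then have l: "Poly_Mapping.lookup (Abs_poly_mapping f) = f"
    by (intro Abs_poly_mapping_inverse) (auto intro: finite_subset)
  then have "Abs_poly_mapping f \<in> Rn N" using sub by (auto simp: Rn_def in_keys_iff)
  then show "f \<in> Poly_Mapping.lookup ` Rn N" using l by (metis image_eqI)
qed (force simp: Rn_def in_keys_iff)

lemma subspace_Rn: "subspace (Rn N)"
  by (simp add: subspace_def Rn_def in_keys_iff subset_iff lookup_add) (metis add.right_neutral)

lemma dim_Rn: "dim (Rn N) = N"
proof -
  let ?e = "\<lambda>i. Poly_Mapping.single i (1::real)"
  have lookup_sum: "Poly_Mapping.lookup (\<Sum>i<N. c i *\<^sub>R ?e i) k = (if k < N then c k else 0)"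
    for c :: "nat \<Rightarrow> real" and k
    by (simp add: Poly_Mapping.lookup_sum lookup_single when_def if_distrib cong: if_cong)
  have inj: "inj_on ?e {..<N}"
    by (rule inj_onI) (metis lookup_single_eq lookup_single_not_eq zero_neq_one)
  have "independent (?e ` {..<N})"
  proof (rule independent_if_scalars_zero)
    fix c x assume z: "(\<Sum>x\<in>?e ` {..<N}. c x *\<^sub>R x) = 0" and "x \<in> ?e ` {..<N}"
    then obtain i where i: "i < N" "x = ?e i" by auto
    have "(\<Sum>j<N. c (?e j) *\<^sub>R ?e j) = 0" using z by (simp add: sum.reindex[OF inj])
    then show "c x = 0" using lookup_sum[of "\<lambda>j. c (?e j)" i] i by simp
  qed simp
  moreover have "?e ` {..<N} \<subseteq> Rn N" by (auto simp: Rn_def)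
  moreover have "Rn N \<subseteq> span (?e ` {..<N})"
  proof
    fix x :: seq assume "x \<in> Rn N"
    then have "x = (\<Sum>i<N. Poly_Mapping.lookup x i *\<^sub>R ?e i)"
      by (intro poly_mapping_eqI) (auto simp: lookup_sum Rn_def in_keys_iff)
    also have "\<dots> \<in> span (?e ` {..<N})"
      by (intro span_sum span_scale span_base) auto
    finally show "x \<in> span (?e ` {..<N})" .
  qed
  ultimately show ?thesis
    using dim_unique[of "?e ` {..<N}" "Rn N" N] by (simp add: card_image[OF inj])
qed

definition Grassmannian :: "nat \<Rightarrow> nat \<Rightarrow> seq set set" where
  "Grassmannian n N = {V. subspace V \<and> V \<subseteq> Rn N \<and> dim V = n}"

definition hausdorff_dist :: "'a::metric_space set \<Rightarrow> 'a set \<Rightarrow> real" where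
  "hausdorff_dist A B = max (SUP a\<in>A. infdist a B) (SUP b\<in>B. infdist b A)"

text \<open>
  A metric for the usual topology of the Grassmannian: the Hausdorff distance of the unit balls is
  \<open>\<parallel>P\<^sub>V - P\<^sub>W\<parallel>\<close>, where \<open>P\<^sub>V\<close>, \<open>P\<^sub>W\<close> are the orthogonal projections and \<open>dim V = dim W\<close>.
\<close>
definition gap_dist :: "seq set \<Rightarrow> seq set \<Rightarrow> real" where
  "gap_dist V W = hausdorff_dist (V \<inter> cball 0 1) (W \<inter> cball 0 1)"

definition continuous_family :: "nat \<Rightarrow> nat \<Rightarrow> (seq set \<Rightarrow> seq set) \<Rightarrow> bool" where
  "continuous_family n N B \<longleftrightarrow>
     (\<forall>V\<in>Grassmannian n N. B V \<noteq> {} \<and> compact (B V) \<and> convex (B V) \<and> B V \<subseteq> V) \<and>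
     (\<forall>V\<in>Grassmannian n N. \<forall>\<epsilon>>0. \<exists>\<eta>>0. \<forall>W\<in>Grassmannian n N.
        gap_dist V W < \<eta> \<longrightarrow> hausdorff_dist (B V) (B W) < \<epsilon>)"

definition convex_body :: "seq set \<Rightarrow> seq set \<Rightarrow> bool" where
  "convex_body V K \<longleftrightarrow>
     K \<subseteq> V \<and> compact K \<and> convex K \<and> (top_of_set V) interior_of K \<noteq> {}"

definition symmetric :: "seq set \<Rightarrow> bool" where
  "symmetric K \<longleftrightarrow> uminus ` K = K"

text \<open>The centre of a ball is an arbitrary point of \<open>V\<close>.\<close>
definition euclidean_ball :: "seq set \<Rightarrow> seq set \<Rightarrow> bool" where
  "euclidean_ball V D \<longleftrightarrow> (\<exists>c\<in>V. \<exists>r>0. D = cball c r \<inter> V)"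

definition body_dist :: "seq set \<Rightarrow> seq set \<Rightarrow> real" where
  "body_dist K L =
     Inf {ln (t / s) | s t. 0 < s \<and> 0 < t \<and> (*\<^sub>R) s ` K \<subseteq> L \<and> L \<subseteq> (*\<^sub>R) t ` K}"

end

theory Submission
  imports Defs
begin

text \<open>
  The bodies are ellipsoids \<open>T(unit ball of V)\<close> with \<open>T = 2 P + A / low A\<close>, where \<open>P\<close> is the orthogonal
  projection onto \<open>V\<close> and \<open>A = A\<^sub>V \<noteq> 0\<close> is a selfadjoint traceless operator on \<open>V\<close> whose least eigenvalue is
  \<open>- low A\<close>: such a \<open>T\<close> has an eigenvalue \<open>1\<close> and an eigenvalue \<open>\<ge> 2\<close>, so it is never close to a
  ball. It remains to find a continuous nowhere vanishing field \<open>V \<mapsto> A\<^sub>V\<close>; because the bodies only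
  depend on \<open>A\<^sub>V\<close> up to scaling, no uniform control in \<open>N\<close> is needed.

  Such a field exists because, on the nonzero traceless selfadjoint operators of \<open>\<real>\<^sup>n\<close>, the equivariant map
  \<open>A \<mapsto> A\<^sup>2 + \<theta> (low A) A - scalar\<close> with \<open>\<theta> = (n - 3) / (n - 1)\<close> has no zeros and is, non-equivariantly,
  homotopic to a constant: fix a skew \<open>J\<close> whose kernel is spanned by one vector \<open>e\<close> (here \<open>n\<close> must be odd);
  then \<open>A\<^sup>2 + \<theta> (low A) A + [A, J] + r e e\<^sup>T - scalar\<close> does not vanish for any \<open>r \<ge> 0\<close>, and as
  \<open>r \<rightarrow> \<infinity>\<close> its direction tends to that of \<open>e e\<^sup>T - scalar\<close>. It does not even vanish for \<open>A = 0\<close> if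
  \<open>r > 0\<close>. So one starts with the zero field and applies these maps one after the other for finitely many
  charts of the Grassmannian. The chart provides \<open>J\<close> and \<open>e\<close>, both polynomial in \<open>P\<close>, and
  \<open>r = r(V) \<ge> 0\<close> is positive exactly where the chart is usable. A step never creates zeros and
  removes those inside its chart.
\<close>

section \<open>The linear algebra of a vanishing step, in an eigenbasis\<close>

lemma finite_attains_min:
  fixes f :: "'i \<Rightarrow> real"
  assumes "finite S" "S \<noteq> {}"
  obtains v where "v \<in> S" "\<And>b. b \<in> S \<Longrightarrow> f v \<le> f b"
  using ex_is_arg_min_if_finite[OF assms, of f] unfolding is_arg_min_linorder by blast

text \<open>Two values \<open>-m\<close> contribute \<open>-2m\<close>, while the other
  \<open>n - 2\<close> contribute at most \<open>2m (n - 2)/(n - 1) < 2m\<close>.\<close>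

lemma two_minima_sum_neg:
  fixes \<alpha> :: "'i \<Rightarrow> real"
  assumes "finite E" "card E = n" "n \<ge> 3" "b \<in> E" "c \<in> E" "b \<noteq> c" "\<alpha> b = -m" "\<alpha> c = -m" "m > 0"
    and le: "\<And>d. d \<in> E \<Longrightarrow> \<alpha> d \<le> 2 / (real n - 1) * m"
  shows "sum \<alpha> E < 0"
proof -
  let ?R = "E - {b, c}"
  have "sum \<alpha> E = sum \<alpha> ?R + sum \<alpha> {b, c}"
    using assms by (intro sum.subset_diff) auto
  also have "sum \<alpha> {b, c} = - 2 * m"
    using assms by simp
  also have "card ?R = n - 2"
    using assms by (simp add: card_Diff_subset)
  then have "sum \<alpha> ?R \<le> real (n - 2) * (2 / (real n - 1) * m)"
    using sum_bounded_above[of ?R \<alpha> "2 / (real n - 1) * m"] le by auto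
  moreover have "real (n - 2) * (2 / (real n - 1) * m) < 2 * m"
  proof -
    have "real (n - 2) * 2 / (real n - 1) < 2"
      using \<open>n \<ge> 3\<close> by (simp add: field_simps of_nat_diff)
    then have "real (n - 2) * 2 / (real n - 1) * m < 2 * m"
      using \<open>m > 0\<close> by (rule mult_strict_right_mono)
    then show ?thesis
      by (simp add: field_simps)
  qed
  ultimately show ?thesis
    by simp
qed

text \<open>
  The matrix entries of \<open>A\<^sup>2 + \<theta> m A + [A, J] + r e e\<^sup>T = l I\<close> in an orthonormal eigenbasis \<open>E\<close> of \<open>A\<close>:
  \<open>\<alpha>\<close> are the eigenvalues, \<open>x\<close> the coordinates of \<open>e\<close> and \<open>j b c = \<langle>J b, c\<rangle>\<close>.
\<close>
locale rank_one_system =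
  fixes E :: "'i set" and n :: nat and \<alpha> x :: "'i \<Rightarrow> real" and j :: "'i \<Rightarrow> 'i \<Rightarrow> real"
    and m r l :: real
  assumes finite_E: "finite E" and card_E: "card E = n" and n: "n \<ge> 3"
    and skew: "\<And>b c. j b c = - j c b"
    and kernel: "\<And>b. b \<in> E \<Longrightarrow> (\<Sum>c\<in>E. j b c * x c) = 0"
    and diag: "\<And>b. b \<in> E \<Longrightarrow> (\<alpha> b)\<^sup>2 + (real n - 3) / (real n - 1) * m * \<alpha> b + r * (x b)\<^sup>2 = l"
    and off: "\<And>b c. b \<in> E \<Longrightarrow> c \<in> E \<Longrightarrow> b \<noteq> c \<Longrightarrow> (\<alpha> c - \<alpha> b) * j b c + r * x b * x c = 0"
    and trace: "(\<Sum>b\<in>E. \<alpha> b) = 0"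
    and lower: "\<And>b. b \<in> E \<Longrightarrow> - m \<le> \<alpha> b"
    and attained: "\<exists>b\<in>E. \<alpha> b = - m"
    and r: "r \<ge> 0"
    and regular: "r > 0 \<Longrightarrow> (\<exists>b\<in>E. x b \<noteq> 0) \<and> (\<forall>b\<in>E. x b = 0 \<longrightarrow> (\<exists>c\<in>E. j b c \<noteq> 0))"
begin

text \<open>If \<open>-m\<close> is a root of \<open>a^2 + (1 - \<kappa>) m a = const\<close>, then
  the other root is \<open>\<kappa> m\<close>, and \<open>n - 1\<close> copies of it add up to
  \<open>2m\<close>.\<close>

definition "\<kappa> = 2 / (real n - 1)"

lemma \<kappa>_pos: "\<kappa> > 0"
  using n by (simp add: \<kappa>_def)

lemma one_minus_\<kappa>: "(real n - 3) / (real n - 1) = 1 - \<kappa>"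
  using n by (simp add: \<kappa>_def field_simps)

lemma two_minima_trace:
  assumes "b \<in> E" "c \<in> E" "b \<noteq> c" "\<alpha> b = -m" "\<alpha> c = -m" "m > 0"
    and "\<And>d. d \<in> E \<Longrightarrow> \<alpha> d \<le> \<kappa> * m"
  shows False
  using two_minima_sum_neg[OF finite_E card_E n assms(1-6)] assms(7) trace by (simp add: \<kappa>_def)

lemma j_self: "j b b = 0"
  using skew[of b b] by simp

lemma m_nonneg: "m \<ge> 0"
proof (rule ccontr)
  assume "\<not> m \<ge> 0"
  then have "\<And>b. b \<in> E \<Longrightarrow> \<alpha> b > 0"
    using lower by force
  then have "sum \<alpha> E > 0"
    using finite_E card_E n by (intro sum_pos) auto
  then show False
    using trace by simp
qed

lemma m_zero:
  assumes "m = 0" "b \<in> E"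
  shows "\<alpha> b = 0"
proof -
  have "\<And>c. c \<in> E \<Longrightarrow> 0 \<le> \<alpha> c"
    using lower assms(1) by fastforce
  then show ?thesis
    using sum_nonneg_eq_0_iff[OF finite_E, of \<alpha>] trace assms(2) by blast
qed

text \<open>For \<open>r = 0\<close> all eigenvalues solve one quadratic with roots
  \<open>-m\<close> and \<open>\<kappa> m\<close>. If \<open>m > 0\<close>, the trace condition
  allows only one of them to be \<open>-m\<close>, but then the trace is
  \<open>2m - m = m\<close>.\<close>

lemma no_rank_one_part:
  assumes "r = 0" and "b \<in> E"
  shows "\<alpha> b = 0"
proof (cases "m = 0")
  case True
  then show ?thesis
    using m_zero assms by simp
next
  case False
  then have m: "m > 0"
    using m_nonneg by simp
  obtain b0 where b0: "b0 \<in> E" "\<alpha> b0 = -m"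
    using attained by blast
  have two: "\<alpha> d = -m \<or> \<alpha> d = \<kappa> * m" if "d \<in> E" for d
  proof -
    have "(\<alpha> d + m) * (\<alpha> d - \<kappa> * m) = 0"
      using diag[OF that] diag[OF b0(1)] b0(2) \<open>r = 0\<close> unfolding one_minus_\<kappa> 
      by (simp add: algebra_simps power2_eq_square)
    then show ?thesis
      by auto
  qed
  have le: "\<alpha> d \<le> \<kappa> * m" if "d \<in> E" for d
    using two[OF that] m mult_pos_pos[OF \<kappa>_pos m] by linarith
  have "\<alpha> d = \<kappa> * m" if "d \<in> E - {b0}" for d
    using two_minima_trace[OF b0(1), of d] two[of d] le that m b0
    by auto
  then have "sum \<alpha> (E - {b0}) = real (card (E - {b0})) * (\<kappa> * m)"
    by simp
  also have "card (E - {b0}) = n - 1"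
    using card_E b0 finite_E by simp
  also have "real (n - 1) * (\<kappa> * m) = 2 * m"
    using n by (simp add: \<kappa>_def field_simps of_nat_diff)
  finally have "sum \<alpha> E = m"
    using sum.remove[OF finite_E b0(1), of \<alpha>] b0(2) by simp
  then show ?thesis
    using trace m by simp
qed

text \<open>
  \<open>e\<close> is an eigenvector of \<open>A\<close>: take \<open>v\<close> with the least eigenvalue among the basis vectors not
  orthogonal to \<open>e\<close>, and pair row \<open>v\<close> of the equation with \<open>J v\<close>, which is orthogonal to \<open>e\<close>.
\<close>
lemma rank_one_aligned:
  assumes "r > 0"
  obtains v where "v \<in> E" "x v \<noteq> 0" "\<And>b. b \<in> E \<Longrightarrow> b \<noteq> v \<Longrightarrow> x b = 0"
proof -
  let ?S = "{b \<in> E. x b \<noteq> 0}"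
  have "finite ?S" "?S \<noteq> {}"
    using finite_E regular assms by auto
  then obtain v where v: "v \<in> ?S" "\<And>b. b \<in> ?S \<Longrightarrow> \<alpha> v \<le> \<alpha> b"
    using finite_attains_min[of ?S \<alpha>] by blast
  have step: "(\<alpha> b - \<alpha> v) * j v b = - r * x v * x b" if "b \<in> E" "b \<noteq> v" for b
    using off[of v b] that v by simp
  have "(\<Sum>b\<in>E. (\<alpha> b - \<alpha> v) * (j v b)\<^sup>2) = (\<Sum>b\<in>E. - r * x v * (j v b * x b))"
  proof (rule sum.cong[OF refl])
    fix b assume "b \<in> E"
    show "(\<alpha> b - \<alpha> v) * (j v b)\<^sup>2 = - r * x v * (j v b * x b)"
    proof (cases "b = v")
      case True
      then show ?thesis by (simp add: j_self)
    next
      case False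
      then show ?thesis
        using step[OF \<open>b \<in> E\<close> False] by (simp add: power2_eq_square mult.assoc[symmetric])
    qed
  qed
  also have "\<dots> = - r * x v * (\<Sum>b\<in>E. j v b * x b)"
    by (rule sum_distrib_left[symmetric])
  also have "\<dots> = 0"
    using kernel[of v] v by simp
  finally have "(\<Sum>b\<in>E. (\<alpha> b - \<alpha> v) * (j v b)\<^sup>2) = 0" .
  \<comment> \<open>If \<open>x b = 0\<close>, \<open>step\<close> makes the term vanish; otherwise
    minimality of \<open>v\<close> makes its first factor nonnegative.\<close>
  moreover have "0 \<le> (\<alpha> b - \<alpha> v) * (j v b)\<^sup>2" if "b \<in> E" for b
  proof (cases "x b = 0 \<and> b \<noteq> v")
    case True
    then show ?thesis
      using step[OF that] by auto
  next
    case False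
    then show ?thesis
      using v that by (auto simp: j_self)
  qed
  ultimately have z: "(\<alpha> b - \<alpha> v) * (j v b)\<^sup>2 = 0" if "b \<in> E" for b
    using sum_nonneg_eq_0_iff[OF finite_E, of "\<lambda>b. (\<alpha> b - \<alpha> v) * (j v b)\<^sup>2"] that by blast
  have "x b = 0" if "b \<in> E" "b \<noteq> v" for b
    using step[OF that] z[OF that(1)] v assms by auto
  then show ?thesis
    using that v by blast
qed

text \<open>
  Off \<open>v\<close> the eigenvalues solve a quadratic equation, and \<open>J\<close> commutes with \<open>A\<close>, so it produces a second
  eigenvector for the smaller root; two such eigenvalues force a negative trace.
\<close>
lemma no_regular_zero: "\<not> r > 0"
proof
  assume r0: "r > 0"
  then obtain v where v: "v \<in> E" "x v \<noteq> 0" and xv: "\<And>b. b \<in> E \<Longrightarrow> b \<noteq> v \<Longrightarrow> x b = 0"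
    using rank_one_aligned by blast
  define f where "f a = a\<^sup>2 + (1 - \<kappa>) * m * a" for a
  have fl: "f (\<alpha> b) = l" if "b \<in> E - {v}" for b
    using diag[of b] xv that unfolding f_def one_minus_\<kappa> by auto
  \<comment> \<open>The rank-one term pushes \<open>\<alpha> v\<close> strictly between the two
    roots of \<open>f a = l\<close>.\<close>
  have fv: "f (\<alpha> v) < l"
  proof -
    have "r * (x v)\<^sup>2 > 0"
      using r0 v by simp
    then show ?thesis
      using diag[of v] v unfolding f_def one_minus_\<kappa> by linarith
  qed
  have comm: "(\<alpha> c - \<alpha> b) * j b c = 0" if "b \<in> E" "c \<in> E" for b c
    using off[OF that] xv[OF that(1)] xv[OF that(2)] by (cases "b = c"; cases "b = v") auto
  let ?F = "E - {v}"
  have F: "finite ?F" "card ?F = n - 1" "?F \<noteq> {}"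
  proof -
    show "finite ?F" "card ?F = n - 1"
      using finite_E card_E v by simp_all
    then show "?F \<noteq> {}"
      using n by (intro notI) simp
  qed
  then obtain b where b: "b \<in> ?F" "\<And>c. c \<in> ?F \<Longrightarrow> \<alpha> b \<le> \<alpha> c"
    using finite_attains_min[of ?F \<alpha>] by blast
  \<comment> \<open>Regularity supplies some \<open>c\<close> that J links to \<open>b\<close>; the
    kernel relation excludes \<open>v\<close>, and commutation gives \<open>c\<close> the same
    eigenvalue as \<open>b\<close>.\<close>
  obtain c where c: "c \<in> E" "j b c \<noteq> 0"
    using regular r0 b xv by blast
  have "c \<noteq> b" using c j_self by auto
  have "c \<noteq> v"
  proof
    assume "c = v"
    have "(\<Sum>d\<in>E. j b d * x d) = (\<Sum>d\<in>{v}. j b d * x d)"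
      by (rule sum.mono_neutral_right) (use finite_E v xv in auto)
    then show False
      using kernel[of b] b c v \<open>c = v\<close> by auto
  qed
  have cb: "\<alpha> c = \<alpha> b"
    using comm[of b c] b c by auto
  define y where "y = \<alpha> b"
  \<comment> \<open>By Vieta, the root of \<open>f a = l\<close> besides \<open>y\<close>.\<close>
  define z where "z = - (1 - \<kappa>) * m - y"
  have root: "f a - l = (a - y) * (a - z)" for a
    using fl[OF b(1)] unfolding f_def z_def y_def by (simp add: algebra_simps power2_eq_square)
  have two: "\<alpha> d = y \<or> \<alpha> d = z" if "d \<in> ?F" for d
    using root[of "\<alpha> d"] fl[OF that] by simp
  have v_between: "(\<alpha> v - y) * (\<alpha> v - z) < 0"
    using root[of "\<alpha> v"] fv by linarith
  show False
  proof (cases "\<forall>d\<in>?F. \<alpha> d = y")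
    case True
    then have "sum \<alpha> ?F = real (n - 1) * y"
      using F by simp
    then have av: "\<alpha> v = - (real n - 1) * y"
      using sum.remove[OF finite_E v(1), of \<alpha>] trace n by (simp add: of_nat_diff algebra_simps)
    \<comment> \<open>This is \<open>v_between\<close> rewritten. For \<open>y >= 0\<close> the
      least eigenvalue is that of \<open>v\<close>, so \<open>m = (n - 1) y\<close>; for
      \<open>y < 0\<close> both factors are nonpositive.\<close>
    have "n * y * ((real n - 2) * y - (1 - \<kappa>) * m) < 0"
      using v_between unfolding av z_def by (simp add: algebra_simps)
    moreover have "n * y * ((real n - 2) * y - (1 - \<kappa>) * m) \<ge> 0"
    proof (cases "y \<ge> 0")
      case True
      have m: "m = (real n - 1) * y"
        using attained
      proof
        fix b0 assume "b0 \<in> E" "\<alpha> b0 = -m"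
        then show ?thesis
          using lower[of v] v(1) av m_nonneg True \<open>\<forall>d\<in>?F. \<alpha> d = y\<close> n
          by (cases "b0 = v") (auto intro!: antisym[of m] simp: algebra_simps)
      qed
      have "(1 - \<kappa>) * m = (real n - 3) * y"
        unfolding m one_minus_\<kappa>[symmetric] using n by simp
      then have "(real n - 2) * y - (1 - \<kappa>) * m = y"
        by (simp add: algebra_simps)
      then show ?thesis
        using True by simp
    next
      case False
      have "(real n - 2) * y \<le> 0"
        using False n by (simp add: mult_nonneg_nonpos)
      moreover have "(1 - \<kappa>) * m \<ge> 0"
        using m_nonneg n by (simp add: one_minus_\<kappa>[symmetric])
      ultimately show ?thesis
        using False by (intro mult_nonpos_nonpos) (auto simp: mult_nonneg_nonpos)
    qed
    ultimately show False by simp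
  next
    case False
    then obtain d where d: "d \<in> ?F" "\<alpha> d = z" "z \<noteq> y"
      using two by blast
    then have yz: "y < z"
      using b(2)[OF d(1)] unfolding y_def by simp
    then have vb: "y < \<alpha> v" "\<alpha> v < z"
      using v_between by (auto simp: mult_less_0_iff)
    have ym: "y = - m"
      using attained
    proof
      fix b0 assume "b0 \<in> E" "\<alpha> b0 = -m"
      then show ?thesis
        using lower[of b] b vb by (cases "b0 = v") (force simp: y_def)+
    qed
    then have z: "z = \<kappa> * m"
      unfolding z_def by (simp add: algebra_simps)
    have m: "m > 0"
      using m_nonneg yz ym z by (cases "m = 0") auto
    have "\<alpha> d \<le> \<kappa> * m" if "d \<in> E" for d
      using that two[of d] vb yz z by (cases "d = v") force+
    then show False
      using two_minima_trace[of b c] b c cb ym m \<open>c \<noteq> b\<close>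
      unfolding y_def by auto
  qed
qed

end

section \<open>Orthonormal systems and the spectral theorem\<close>

definition orthonormal :: "'a::real_inner set \<Rightarrow> bool" where
  "orthonormal E \<longleftrightarrow> finite E \<and> (\<forall>x\<in>E. \<forall>y\<in>E. x \<bullet> y = (if x = y then 1 else 0))"

lemma orthonormal_finite: "orthonormal E \<Longrightarrow> finite E"
  by (simp add: orthonormal_def)

lemma orthonormal_inner:
  "orthonormal E \<Longrightarrow> x \<in> E \<Longrightarrow> y \<in> E \<Longrightarrow> x \<bullet> y = (if x = y then 1 else 0)"
  by (simp add: orthonormal_def)

lemma orthonormal_norm: "orthonormal E \<Longrightarrow> x \<in> E \<Longrightarrow> norm x = 1"
  by (simp add: norm_eq_sqrt_inner orthonormal_inner)

lemma inner_sum_orthonormal: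
  assumes "orthonormal E" "b \<in> E"
  shows "(\<Sum>c\<in>E. f c *\<^sub>R c) \<bullet> b = f b"
proof -
  have "(\<Sum>c\<in>E. f c *\<^sub>R c) \<bullet> b = (\<Sum>c\<in>E. if c = b then f c else 0)"
    unfolding inner_sum_left by (rule sum.cong) (use assms in \<open>auto simp: orthonormal_inner\<close>)
  then show ?thesis
    using assms by (simp add: orthonormal_finite)
qed

lemma orthonormal_independent:
  assumes "orthonormal E"
  shows "independent E"
proof (rule pairwise_orthogonal_independent)
  show "pairwise orthogonal E"
    using assms by (simp add: pairwise_def orthogonal_def orthonormal_inner)
  show "0 \<notin> E"
    using assms orthonormal_norm by force
qed

lemma orthonormal_dim: "orthonormal E \<Longrightarrow> dim (span E) = card E"
  by (simp add: dim_eq_card_independent orthonormal_independent)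

lemma orthonormal_expansion:
  assumes "orthonormal E" "x \<in> span E"
  shows "x = (\<Sum>b\<in>E. (x \<bullet> b) *\<^sub>R b)"
proof -
  obtain f where f: "x = (\<Sum>b\<in>E. f b *\<^sub>R b)"
    using assms span_finite[of E] orthonormal_finite by auto
  then have "x \<bullet> b = f b" if "b \<in> E" for b
    using inner_sum_orthonormal[OF assms(1) that] by simp
  then show ?thesis
    using f by (metis (no_types, lifting) sum.cong)
qed

lemma orthonormal_inner_expansion:
  assumes "orthonormal E" "x \<in> span E"
  shows "x \<bullet> y = (\<Sum>b\<in>E. (x \<bullet> b) * (y \<bullet> b))"
proof -
  have "x \<bullet> y = (\<Sum>b\<in>E. (x \<bullet> b) *\<^sub>R b) \<bullet> y"
    using orthonormal_expansion[OF assms] by simp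
  also have "\<dots> = (\<Sum>b\<in>E. (x \<bullet> b) * (y \<bullet> b))"
    unfolding inner_sum_left by (intro sum.cong refl) (simp add: inner_commute)
  finally show ?thesis .
qed

lemma orthonormal_span_eqI:
  assumes "orthonormal E" "x \<in> span E" "y \<in> span E" "\<And>b. b \<in> E \<Longrightarrow> x \<bullet> b = y \<bullet> b"
  shows "x = y"
  using orthonormal_expansion[OF assms(1,2)] orthonormal_expansion[OF assms(1,3)] assms(4)
  by (metis (no_types, lifting) sum.cong)

lemma ex_orthonormal_span:
  fixes F :: "'a::real_inner set"
  assumes "finite F"
  shows "\<exists>E. orthonormal E \<and> span E = span F"
proof -
  obtain C where C: "finite C" "span C = span F" "pairwise orthogonal C"
    using basis_orthogonal[OF assms] by blast
  define E where "E = (\<lambda>x. x /\<^sub>R norm x) ` (C - {0})"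
  have orth: "x \<bullet> y = 0" if "x \<in> C" "y \<in> C" "x \<noteq> y" for x y
    using C that by (auto simp: pairwise_def orthogonal_def)
  have "orthonormal E"
    unfolding orthonormal_def
  proof (intro conjI ballI)
    show "finite E"
      using C by (simp add: E_def)
    fix u v assume "u \<in> E" "v \<in> E"
    then obtain x y where xy: "x \<in> C - {0}" "y \<in> C - {0}" "u = x /\<^sub>R norm x" "v = y /\<^sub>R norm y"
      unfolding E_def by blast
    show "u \<bullet> v = (if u = v then 1 else 0)"
    proof (cases "x = y")
      case True
      then show ?thesis
        using xy by (simp add: dot_square_norm power2_eq_square)
    next
      case False
      then have "u \<bullet> v = 0"
        using orth xy by simp
      moreover have "u \<bullet> u \<noteq> 0"
        using xy by simp
      ultimately show ?thesis
        by auto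
    qed
  qed
  moreover have "span E = span F"
  proof -
    have "E \<subseteq> span C"
      unfolding E_def by (auto intro: span_scale span_base)
    moreover have "C \<subseteq> span E"
    proof
      fix x assume "x \<in> C"
      show "x \<in> span E"
      proof (cases "x = 0")
        case False
        then have "x = norm x *\<^sub>R (x /\<^sub>R norm x)"
          by simp
        also have "\<dots> \<in> span E"
          using \<open>x \<in> C\<close> False by (intro span_scale span_base) (auto simp: E_def)
        finally show ?thesis .
      qed (simp add: span_zero)
    qed
    ultimately show ?thesis
      using C(2) by (metis span_eq)
  qed
  ultimately show ?thesis
    by blast
qed

text \<open>The ambient space may be infinite-dimensional; the finite set \<open>F\<close> is what
  bounds the dimension of \<open>V\<close>.\<close>

lemma ex_orthonormal_subspace:
  fixes F :: "'a::real_inner set"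
  assumes "finite F" "subspace V" "V \<subseteq> span F"
  shows "\<exists>E. orthonormal E \<and> span E = V"
proof -
  obtain B where B: "B \<subseteq> V" "independent B" "V \<subseteq> span B"
    using maximal_independent_subset by blast
  have "finite B"
    using independent_span_bound[OF assms(1) B(2)] B(1) assms(3) by blast
  moreover have "span B = V"
    using B assms(2) by (simp add: span_subspace)
  ultimately show ?thesis
    using ex_orthonormal_span by metis
qed

section \<open>Compactness of unit balls in finite-dimensional subspaces\<close>

text \<open>The type itself need not be finite-dimensional, so compactness is built up through
  Minkowski sums of segments.\<close>

lemma compact_box_span:
  fixes E :: "'a::real_normed_vector set"
  assumes "finite E"
  shows "compact {x. \<exists>f. (\<forall>b\<in>E. \<bar>f b\<bar> \<le> 1) \<and> x = (\<Sum>b\<in>E. f b *\<^sub>R b)}" (is "compact (?B E)")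
  using assms
proof (induction E)
  case empty
  then show ?case by simp
next
  case (insert v E)
  have "compact ((\<lambda>t. t *\<^sub>R v) ` {-1..1})"
    by (intro compact_continuous_image continuous_intros) auto
  then have "compact {x + y |x y. x \<in> (\<lambda>t. t *\<^sub>R v) ` {-1..1} \<and> y \<in> ?B E}"
    using insert.IH by (rule compact_sums)
  moreover have "?B (insert v E) = {x + y |x y. x \<in> (\<lambda>t. t *\<^sub>R v) ` {-1..1} \<and> y \<in> ?B E}"
    (is "_ = ?R")
  proof (intro set_eqI iffI)
    fix x assume "x \<in> ?B (insert v E)"
    then obtain f where f: "\<forall>b\<in>insert v E. \<bar>f b\<bar> \<le> 1" "x = (\<Sum>b\<in>insert v E. f b *\<^sub>R b)"
      by blast
    then have "x = f v *\<^sub>R v + (\<Sum>b\<in>E. f b *\<^sub>R b)"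
      using insert.hyps by simp
    moreover have "f v *\<^sub>R v \<in> (\<lambda>t. t *\<^sub>R v) ` {-1..1}"
      using f by (auto simp: abs_le_iff)
    ultimately show "x \<in> ?R"
      using f by blast
  next
    fix x assume "x \<in> ?R"
    then obtain t f where f: "\<bar>t\<bar> \<le> 1" "\<forall>b\<in>E. \<bar>f b\<bar> \<le> 1" "x = t *\<^sub>R v + (\<Sum>b\<in>E. f b *\<^sub>R b)"
      by (fastforce simp: abs_le_iff)
    have "x = (\<Sum>b\<in>insert v E. (f(v := t)) b *\<^sub>R b)"
      using insert.hyps f(3) by (simp, intro sum.cong) auto
    then show "x \<in> ?B (insert v E)"
      using f by (intro CollectI exI[of _ "f(v := t)"]) auto
  qed
  ultimately show ?case by simp
qed

text \<open>Coordinates of vectors in the unit ball are at most 1, so the ball is a closed part of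
  the compact box.\<close>

lemma compact_span_cball:
  assumes "orthonormal E"
  shows "compact (span E \<inter> cball 0 1)"
proof -
  let ?B = "{x. \<exists>f. (\<forall>b\<in>E. \<bar>f b\<bar> \<le> 1) \<and> x = (\<Sum>b\<in>E. f b *\<^sub>R b)}"
  have "span E \<inter> cball 0 1 = ?B \<inter> cball 0 1"
  proof (intro set_eqI iffI)
    fix x assume x: "x \<in> span E \<inter> cball 0 1"
    then have "\<bar>x \<bullet> b\<bar> \<le> 1" if "b \<in> E" for b
      using Cauchy_Schwarz_ineq2[of x b] orthonormal_norm[OF assms that] by simp
    then show "x \<in> ?B \<inter> cball 0 1"
      using orthonormal_expansion[OF assms, of x] x by blast
  next
    fix x assume "x \<in> ?B \<inter> cball 0 1"
    then obtain f where "x = (\<Sum>b\<in>E. f b *\<^sub>R b)" "x \<in> cball 0 1"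
      by blast
    then show "x \<in> span E \<inter> cball 0 1"
      by (blast intro: span_sum span_scale span_base)
  qed
  then show ?thesis
    using compact_box_span[OF orthonormal_finite[OF assms]] by (simp add: compact_Int_closed)
qed

lemma compact_span_sphere:
  assumes "orthonormal E"
  shows "compact (span E \<inter> sphere 0 1)"
proof -
  have "span E \<inter> sphere 0 1 = (span E \<inter> cball 0 1) \<inter> sphere 0 1"
    by auto
  then show ?thesis
    using compact_Int_closed[OF compact_span_cball[OF assms], of "sphere 0 1"]
    by (simp add: sphere_def closed_Collect_eq continuous_intros)
qed

section \<open>The spectral theorem\<close>

text \<open>A maximiser \<open>v\<close> of the quadratic form of \<open>A\<close> on the unit
  sphere is an eigenvector: \<open>g\<close> is nonnegative and vanishes at \<open>v\<close>, so
  moving from \<open>v\<close> along the defect \<open>w = a v - A v\<close> may produce no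
  first-order term.\<close>

lemma ex_eigenvector:
  fixes A :: "'a::real_inner \<Rightarrow>\<^sub>L 'a"
  assumes E: "orthonormal E" "E \<noteq> {}"
    and A: "\<And>x. x \<in> span E \<Longrightarrow> A x \<in> span E"
    and sym: "\<And>x y. A x \<bullet> y = x \<bullet> A y"
  shows "\<exists>v a. v \<in> span E \<and> norm v = 1 \<and> A v = a *\<^sub>R v"
proof -
  let ?S = "span E \<inter> sphere 0 1"
  obtain b where "b \<in> E"
    using E by blast
  then have "b \<in> ?S"
    using orthonormal_norm[OF E(1)] by (simp add: span_base)
  then have "?S \<noteq> {}"
    by blast
  moreover have "continuous_on ?S (\<lambda>x. A x \<bullet> x)"
    by (intro continuous_intros)
  ultimately obtain v where v: "v \<in> ?S" and max: "\<And>x. x \<in> ?S \<Longrightarrow> A x \<bullet> x \<le> A v \<bullet> v"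
    using continuous_attains_sup[OF compact_span_sphere[OF E(1)], of "\<lambda>x. A x \<bullet> x"] by blast
  define a where "a = A v \<bullet> v"
  define g where "g x = a * (x \<bullet> x) - A x \<bullet> x" for x
  have g: "g x \<ge> 0" if "x \<in> span E" for x
  proof (cases "x = 0")
    case False
    then have "x /\<^sub>R norm x \<in> ?S"
      using that by (simp add: span_scale)
    then have "A (x /\<^sub>R norm x) \<bullet> (x /\<^sub>R norm x) \<le> a"
      unfolding a_def by (rule max)
    then have "A x \<bullet> x / (norm x)\<^sup>2 \<le> a"
      by (simp add: blinfun.scaleR_right power2_eq_square divide_inverse mult_ac)
    then show ?thesis
      using False by (simp add: g_def field_simps dot_square_norm)
  qed (simp add: g_def)
  define w where "w = a *\<^sub>R v - A v"
  have w: "w \<in> span E"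
    using v A unfolding w_def by (intro span_diff span_scale) auto
  have vv: "v \<bullet> v = 1"
    using v by (simp add: dot_square_norm)
  have expand: "g (v + s *\<^sub>R w) = 2 * s * (w \<bullet> w) + s\<^sup>2 * g w" for s
  proof -
    have "A w \<bullet> v = w \<bullet> A v"
      by (rule sym)
    then have "g (v + s *\<^sub>R w) = g v + 2 * s * (w \<bullet> (a *\<^sub>R v - A v)) + s\<^sup>2 * g w"
      unfolding g_def
      by (simp add: blinfun.add_right blinfun.scaleR_right inner_add_left inner_add_right
          inner_diff_right inner_commute algebra_simps power2_eq_square)
    moreover have "g v = 0"
      using vv by (simp add: g_def a_def)
    ultimately show ?thesis
      by (simp add: w_def)
  qed
  have "w = 0"
  proof (rule ccontr)
    assume "w \<noteq> 0"
    define p where "p = w \<bullet> w"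
    \<comment> \<open>Negative, and small enough that the quadratic term cannot outweigh the linear
      one.\<close>
    define s where "s = - p / (g w + 1)"
    have p: "p > 0"
      using \<open>w \<noteq> 0\<close> by (simp add: p_def)
    have gw: "g w \<ge> 0"
      using g w by blast
    have "0 \<le> g (v + s *\<^sub>R w)"
      using v w by (intro g span_add span_scale) auto
    also have "\<dots> = s * (2 * p + s * g w)"
      unfolding expand by (simp add: p_def algebra_simps power2_eq_square)
    also have "s * g w \<ge> - p"
      using p gw by (simp add: s_def field_simps)
    then have "s * (2 * p + s * g w) < 0"
      using p gw by (intro mult_neg_pos) (auto simp: s_def divide_neg_pos)
    finally show False by simp
  qed
  then show ?thesis
    using v unfolding w_def by (intro exI[of _ v] exI[of _ a]) auto
qed

text \<open>Split off an eigenvector; by selfadjointness its orthogonal complement in the span is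
  again invariant.\<close>

lemma spectral_theorem:
  fixes A :: "'a::real_inner \<Rightarrow>\<^sub>L 'a"
  assumes "orthonormal E0"
    and "\<And>x. x \<in> span E0 \<Longrightarrow> A x \<in> span E0"
    and sym: "\<And>x y. A x \<bullet> y = x \<bullet> A y"
  shows "\<exists>E \<alpha>. orthonormal E \<and> span E = span E0 \<and> (\<forall>b\<in>E. A b = \<alpha> b *\<^sub>R b)"
  using assms(1,2)
proof (induction "card E0" arbitrary: E0)
  case 0
  then show ?case
    using orthonormal_finite by (intro exI[of _ E0]) force
next
  case (Suc k)
  then obtain v a where v: "v \<in> span E0" "norm v = 1" "A v = a *\<^sub>R v"
    using ex_eigenvector[of E0 A] sym by force
  define V where "V = span E0 \<inter> {x. x \<bullet> v = 0}"
  have vv: "v \<bullet> v = 1"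
    using v by (simp add: dot_square_norm)
  have "subspace V"
    unfolding V_def by (intro subspace_inter subspace_span) (auto simp: subspace_def inner_add_left)
  then obtain E1 where E1: "orthonormal E1" "span E1 = V"
    using ex_orthonormal_subspace[of E0 V] orthonormal_finite[OF Suc.prems(1)] by (auto simp: V_def)
  have extend: "orthonormal (insert v E) \<and> span (insert v E) = span E0 \<and> v \<notin> E"
    if E: "orthonormal E" "span E = V" for E
  proof -
    have perp: "b \<bullet> v = 0" if "b \<in> E" for b
      using span_base[OF that] E by (simp add: V_def)
    then have nv: "v \<notin> E"
      using vv by force
    have on: "orthonormal (insert v E)"
      using E(1) perp nv vv by (auto simp: orthonormal_def inner_commute)
    have "span (insert v E) \<subseteq> span E0"
      using E v by (intro span_minimal subspace_span) (auto simp: V_def dest: span_base)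
    moreover have "x \<in> span (insert v E)" if "x \<in> span E0" for x
    proof -
      have "x - (x \<bullet> v) *\<^sub>R v \<in> V"
        using that v vv by (simp add: V_def span_diff span_scale inner_diff_left)
      then show ?thesis
        unfolding E(2)[symmetric] by (auto simp: span_insert)
    qed
    ultimately show ?thesis
      using on nv by auto
  qed
  have "card (insert v E1) = card E0"
    using extend[OF E1] Suc.prems(1) by (metis orthonormal_dim)
  then have "card E1 = k"
    using extend[OF E1] Suc.hyps(2) orthonormal_finite[OF E1(1)] by simp
  moreover have "A x \<in> span E1" if "x \<in> span E1" for x
    using that Suc.prems(2) v sym[of x v] unfolding E1 V_def by simp
  ultimately obtain E \<alpha> where E: "orthonormal E" "span E = V" "\<forall>b\<in>E. A b = \<alpha> b *\<^sub>R b"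
    using Suc.hyps(1)[of E1] E1 by auto
  then show ?case
    using extend[OF E(1,2)] v(3) by (intro exI[of _ "insert v E"] exI[of _ "\<alpha>(v := a)"]) auto
qed

section \<open>Operators and the iteration step\<close>

text \<open>The rank-one operator \<open>a b^T\<close>, assembled from bounded linear maps so that
  continuity in \<open>a\<close> and \<open>b\<close> is inherited.\<close>

definition outer :: "'a::real_inner \<Rightarrow> 'a \<Rightarrow> 'a \<Rightarrow>\<^sub>L 'a" where
  "outer a b = blinfun_scaleR_left a o\<^sub>L blinfun_inner_right b"

lemma outer_apply [simp]: "outer a b x = (b \<bullet> x) *\<^sub>R a"
  by (simp add: outer_def blinfun_scaleR_left.rep_eq blinfun_inner_right.rep_eq)

lemma continuous_on_outer [continuous_intros]:
  "continuous_on S f \<Longrightarrow> continuous_on S g \<Longrightarrow> continuous_on S (\<lambda>x. outer (f x) (g x))"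
  unfolding outer_def
  by (intro bounded_bilinear.continuous_on[OF bounded_bilinear_blinfun_compose]
      bounded_linear.continuous_on[OF bounded_linear_blinfun_scaleR_left]
      bounded_linear.continuous_on[OF bounded_linear_blinfun_inner_right])

section \<open>Orthogonal projections and the trace\<close>

text \<open>Which basis is chosen does not matter: the lemmas below characterise the operator by
  \<open>V\<close> alone.\<close>

definition orth_proj :: "'a::real_inner set \<Rightarrow> 'a \<Rightarrow>\<^sub>L 'a" where
  "orth_proj V = (\<Sum>b\<in>(SOME E. orthonormal E \<and> span E = V). outer b b)"

lemma orth_proj_some:
  assumes "orthonormal E" "span E = V"
  obtains E' where "orthonormal E'" "span E' = V" "\<And>x. orth_proj V x = (\<Sum>b\<in>E'. (b \<bullet> x) *\<^sub>R b)"
proof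
  let ?E = "SOME E. orthonormal E \<and> span E = V"
  show "orthonormal ?E" "span ?E = V"
    using someI[of "\<lambda>E. orthonormal E \<and> span E = V"] assms by blast+
  show "\<And>x. orth_proj V x = (\<Sum>b\<in>?E. (b \<bullet> x) *\<^sub>R b)"
    by (simp add: orth_proj_def blinfun.sum_left)
qed

lemma orth_proj_in:
  assumes "orthonormal E" "span E = V"
  shows "orth_proj V x \<in> V"
proof -
  obtain E' where "span E' = V" "\<And>x. orth_proj V x = (\<Sum>b\<in>E'. (b \<bullet> x) *\<^sub>R b)"
    using orth_proj_some[OF assms] by metis
  then show ?thesis
    by (metis (no_types, lifting) span_base span_scale span_sum)
qed

lemma orth_proj_id:
  assumes "orthonormal E" "span E = V" "x \<in> V"
  shows "orth_proj V x = x"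
proof -
  obtain E' where "orthonormal E'" "span E' = V" "\<And>x. orth_proj V x = (\<Sum>b\<in>E'. (b \<bullet> x) *\<^sub>R b)"
    using orth_proj_some[OF assms(1,2)] by metis
  then show ?thesis
    using orthonormal_expansion[of E' x] assms(3) by (simp add: inner_commute)
qed

lemma orth_proj_selfadjoint:
  assumes "orthonormal E" "span E = V"
  shows "orth_proj V x \<bullet> y = x \<bullet> orth_proj V y"
proof -
  obtain E' where "\<And>x. orth_proj V x = (\<Sum>b\<in>E'. (b \<bullet> x) *\<^sub>R b)"
    using orth_proj_some[OF assms(1,2)] by metis
  then show ?thesis
    by (simp add: inner_sum_left inner_sum_right inner_commute mult.commute)
qed

lemma orth_proj_inner:
  assumes "orthonormal E" "span E = V" "y \<in> V"
  shows "orth_proj V x \<bullet> y = x \<bullet> y"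
  using orth_proj_selfadjoint[OF assms(1,2)] orth_proj_id[OF assms] by metis

definition selfadjoint :: "('a::real_inner \<Rightarrow>\<^sub>L 'a) \<Rightarrow> bool" where
  "selfadjoint A \<longleftrightarrow> (\<forall>x y. A x \<bullet> y = x \<bullet> A y)"

definition skewadjoint :: "('a::real_inner \<Rightarrow>\<^sub>L 'a) \<Rightarrow> bool" where
  "skewadjoint A \<longleftrightarrow> (\<forall>x y. A x \<bullet> y = - (x \<bullet> A y))"

text \<open>Being selfadjoint with range in \<open>V\<close>, the operator is zero on the orthogonal
  complement of \<open>V\<close>, so the expansion holds at every \<open>x\<close>, not only in
  \<open>V\<close>.\<close>

lemma spectral_expansion:
  assumes "orthonormal E0" "span E0 = V" "selfadjoint A" "\<And>x. A x \<in> V"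
  obtains E \<alpha> where "orthonormal E" "span E = V" "card E = card E0" "\<And>b. b \<in> E \<Longrightarrow> A b = \<alpha> b *\<^sub>R b"
    "\<And>x. A x = (\<Sum>b\<in>E. (\<alpha> b * (x \<bullet> b)) *\<^sub>R b)"
proof -
  obtain E \<alpha> where E: "orthonormal E" "span E = V" "\<And>b. b \<in> E \<Longrightarrow> A b = \<alpha> b *\<^sub>R b"
    using spectral_theorem[OF assms(1), of A] assms(2-4) unfolding selfadjoint_def by metis
  have "A x = (\<Sum>b\<in>E. (\<alpha> b * (x \<bullet> b)) *\<^sub>R b)" for x
  proof -
    have "A x \<bullet> b = \<alpha> b * (x \<bullet> b)" if "b \<in> E" for b
      using assms(3) E(3)[OF that] by (simp add: selfadjoint_def)
    then show ?thesis
      using orthonormal_expansion[OF E(1), of "A x"] assms(4) E(2) by simp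
  qed
  moreover have "card E = card E0"
    using orthonormal_dim[OF E(1)] orthonormal_dim[OF assms(1)] E(2) assms(2) by simp
  ultimately show ?thesis
    using that E by blast
qed

text \<open>The trace is taken over a basis of the ambient space that stays fixed while
  \<open>V\<close> varies, which makes its continuity immediate.\<close>

definition tr :: "'a::real_inner set \<Rightarrow> ('a \<Rightarrow>\<^sub>L 'a) \<Rightarrow> real" where
  "tr F A = (\<Sum>c\<in>F. A c \<bullet> c)"

lemma tr_diff: "tr F (A - B) = tr F A - tr F B"
  by (simp add: tr_def blinfun.diff_left inner_diff_left sum_subtractf)

lemma tr_scaleR: "tr F (a *\<^sub>R A) = a * tr F A"
  by (simp add: tr_def blinfun.scaleR_left sum_distrib_left)

lemma continuous_on_tr [continuous_intros]:
  "continuous_on S f \<Longrightarrow> continuous_on S (\<lambda>x. tr F (f x))"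
  unfolding tr_def by (intro continuous_intros)

text \<open>After swapping the sums, each eigenvector contributes \<open>\<alpha> b\<close> times
  its squared norm, by Parseval in \<open>F\<close>.\<close>

lemma tr_spectral:
  fixes A :: "'a::real_inner \<Rightarrow>\<^sub>L 'a"
  assumes F: "orthonormal F" "E \<subseteq> span F" and E: "orthonormal E"
    and A: "\<And>x. A x = (\<Sum>b\<in>E. (\<alpha> b * (x \<bullet> b)) *\<^sub>R b)"
  shows "tr F A = sum \<alpha> E"
proof -
  have "tr F A = (\<Sum>c\<in>F. \<Sum>b\<in>E. \<alpha> b * ((b \<bullet> c) * (b \<bullet> c)))"
    unfolding tr_def A inner_sum_left
    by (intro sum.cong refl) (simp add: inner_commute)
  also have "\<dots> = (\<Sum>b\<in>E. \<alpha> b * (\<Sum>c\<in>F. (b \<bullet> c) * (b \<bullet> c)))"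
    by (subst sum.swap) (simp add: sum_distrib_left)
  also have "\<dots> = (\<Sum>b\<in>E. \<alpha> b)"
  proof (rule sum.cong[OF refl])
    fix b assume "b \<in> E"
    then have "(\<Sum>c\<in>F. (b \<bullet> c) * (b \<bullet> c)) = 1"
      using orthonormal_inner_expansion[OF F(1), of b b] F(2) E by (auto simp: orthonormal_inner)
    then show "\<alpha> b * (\<Sum>c\<in>F. (b \<bullet> c) * (b \<bullet> c)) = \<alpha> b"
      by simp
  qed
  finally show ?thesis .
qed

lemma tr_orth_proj:
  assumes "orthonormal F" "V \<subseteq> span F" "orthonormal E" "span E = V"
  shows "tr F (orth_proj V) = card E"
proof -
  obtain E' where E': "orthonormal E'" "span E' = V" "\<And>x. orth_proj V x = (\<Sum>b\<in>E'. (b \<bullet> x) *\<^sub>R b)"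
    using orth_proj_some[OF assms(3,4)] by metis
  have "tr F (orth_proj V) = sum (\<lambda>b. 1) E'"
    using assms(2) E' by (intro tr_spectral[OF assms(1) _ E'(1)]) (auto simp: inner_commute dest: span_base)
  then show ?thesis
    using orthonormal_dim[OF E'(1)] orthonormal_dim[OF assms(3)] E'(2) assms(4) by simp
qed

section \<open>Continuous spectral quantities of an operator\<close>

lemma continuous_on_SUP_lipschitz:
  fixes h :: "'b::real_normed_vector \<Rightarrow> 'c \<Rightarrow> real"
  assumes bdd: "\<And>A. bdd_above (h A ` X)"
    and lip: "\<And>A B x. x \<in> X \<Longrightarrow> \<bar>h A x - h B x\<bar> \<le> norm (A - B)"
  shows "continuous_on S (\<lambda>A. SUP x\<in>X. h A x)"
proof (cases "X = {}")
  case False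
  have le: "(SUP x\<in>X. h A x) \<le> (SUP x\<in>X. h B x) + norm (A - B)" for A B
  proof (rule cSUP_least[OF False])
    fix x assume "x \<in> X"
    then show "h A x \<le> (SUP x\<in>X. h B x) + norm (A - B)"
      using cSUP_upper[OF \<open>x \<in> X\<close> bdd[of B]] lip[OF \<open>x \<in> X\<close>, of A B] by linarith
  qed
  have "dist (SUP x\<in>X. h A x) (SUP x\<in>X. h B x) \<le> dist A B" for A B
    using le[of A B] le[of B A] by (simp add: dist_norm norm_minus_commute abs_le_iff)
  then show ?thesis
    unfolding continuous_on_iff by (meson le_less_trans)
qed simp

text \<open>
  On traceless operators \<open>low A\<close> is minus the least eigenvalue (see \<open>low_spectral\<close>).
\<close>
definition low :: "('a::real_inner \<Rightarrow>\<^sub>L 'a) \<Rightarrow> real" where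
  "low A = (SUP x\<in>cball 0 1. - (A x \<bullet> x))"

text \<open>A continuous substitute for the determinant as a test of injectivity: on a nonempty
  sphere it is positive iff \<open>A\<close> is bounded below.\<close>

definition modulus :: "('a::real_inner \<Rightarrow>\<^sub>L 'a) \<Rightarrow> real" where
  "modulus A = (INF x\<in>sphere 0 1. norm (A x))"

lemma norm_inner_unit_ball:
  fixes A :: "'a::real_inner \<Rightarrow>\<^sub>L 'a"
  assumes "x \<in> cball 0 1"
  shows "\<bar>A x \<bullet> x\<bar> \<le> norm A"
proof -
  have x: "norm x \<le> 1"
    using assms by simp
  have "\<bar>A x \<bullet> x\<bar> \<le> norm (A x) * norm x"
    by (rule Cauchy_Schwarz_ineq2)
  also have "\<dots> \<le> (norm A * norm x) * norm x"
    by (intro mult_right_mono norm_blinfun) auto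
  also have "\<dots> \<le> norm A"
    using x by (simp add: mult_le_one mult_left_le mult.assoc)
  finally show ?thesis .
qed

lemma bdd_above_low: "bdd_above ((\<lambda>x. - (A x \<bullet> x)) ` cball 0 1)"
  for A :: "'a::real_inner \<Rightarrow>\<^sub>L 'a"
  by (intro bdd_aboveI2[of _ _ "norm A"]) (use norm_inner_unit_ball[of _ A] in fastforce)

lemma continuous_low: "continuous_on S (low :: ('a::real_inner \<Rightarrow>\<^sub>L 'a) \<Rightarrow> real)"
  unfolding low_def
proof (rule continuous_on_SUP_lipschitz[OF bdd_above_low])
  fix A B :: "'a \<Rightarrow>\<^sub>L 'a" and x :: 'a assume "x \<in> cball 0 1"
  then show "\<bar>- (A x \<bullet> x) - - (B x \<bullet> x)\<bar> \<le> norm (A - B)"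
    using norm_inner_unit_ball[of x "A - B"] by (simp add: blinfun.diff_left inner_diff_left)
qed

lemma continuous_modulus: "continuous_on S (modulus :: ('a::real_inner \<Rightarrow>\<^sub>L 'a) \<Rightarrow> real)"
  unfolding modulus_def Inf_real_def image_image
proof (rule continuous_on_minus, rule continuous_on_SUP_lipschitz)
  fix A :: "'a \<Rightarrow>\<^sub>L 'a"
  show "bdd_above ((\<lambda>x. - norm (A x)) ` sphere 0 1)"
    by (rule bdd_aboveI2[of _ _ 0]) simp
next
  fix A B :: "'a \<Rightarrow>\<^sub>L 'a" and x :: 'a assume "x \<in> sphere 0 1"
  then have "norm ((A - B) x) \<le> norm (A - B)"
    using norm_blinfun[of "A - B" x] by simp
  then show "\<bar>- norm (A x) - - norm (B x)\<bar> \<le> norm (A - B)"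
    using norm_triangle_ineq3[of "A x" "B x"] by (simp add: blinfun.diff_left)
qed

lemmas continuous_on_low =
  continuous_on_compose2[OF continuous_low[of UNIV] _ subset_UNIV]

lemmas continuous_on_modulus =
  continuous_on_compose2[OF continuous_modulus[of UNIV] _ subset_UNIV]

lemmas continuous_on_blinfun_compose =
  bounded_bilinear.continuous_on[OF bounded_bilinear_blinfun_compose]

text \<open>Trace 0 makes the least eigenvalue nonpositive, so by Bessel no vector of the ball, even
  off the span, beats its eigenvector.\<close>

lemma low_spectral:
  fixes A :: "'a::real_inner \<Rightarrow>\<^sub>L 'a"
  assumes E: "orthonormal E" "E \<noteq> {}"
    and A: "\<And>x. A x = (\<Sum>b\<in>E. (\<alpha> b * (x \<bullet> b)) *\<^sub>R b)" and "sum \<alpha> E = 0"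
  shows "(\<forall>b\<in>E. - low A \<le> \<alpha> b) \<and> (\<exists>b\<in>E. \<alpha> b = - low A)"
proof -
  have eig: "A b \<bullet> b = \<alpha> b" if "b \<in> E" for b
    using inner_sum_orthonormal[OF E(1) that] orthonormal_inner[OF E(1) that that] by (simp add: A)
  have ge: "- low A \<le> \<alpha> b" if "b \<in> E" for b
  proof -
    have "- (A b \<bullet> b) \<le> low A"
      unfolding low_def using orthonormal_norm[OF E(1) that]
      by (intro cSUP_upper bdd_above_low) auto
    then show ?thesis
      using eig[OF that] by simp
  qed
  have fin: "finite E"
    using E orthonormal_finite by blast
  obtain b where b: "b \<in> E" "\<And>c. c \<in> E \<Longrightarrow> \<alpha> b \<le> \<alpha> c"
    using finite_attains_min[OF fin E(2), of \<alpha>] by blast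
  have neg: "\<alpha> b \<le> 0"
  proof (rule ccontr)
    assume "\<not> \<alpha> b \<le> 0"
    then have "sum \<alpha> E > 0"
      using fin E(2) b(2) by (intro sum_pos) force+
    then show False
      using assms by simp
  qed
  have "low A \<le> - \<alpha> b"
    unfolding low_def
  proof (rule cSUP_least)
    fix x :: 'a assume x: "x \<in> cball 0 1"
    let ?p = "\<Sum>c\<in>E. (x \<bullet> c) *\<^sub>R c"
    have p: "?p \<in> span E"
      by (intro span_sum span_scale span_base)
    have px: "?p \<bullet> x = (\<Sum>c\<in>E. (x \<bullet> c)\<^sup>2)"
      unfolding inner_sum_left by (intro sum.cong refl) (simp add: inner_commute power2_eq_square)
    have pp: "?p \<bullet> ?p = (\<Sum>c\<in>E. (x \<bullet> c)\<^sup>2)"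
      using orthonormal_inner_expansion[OF E(1) p, of ?p]
      by (simp add: inner_sum_orthonormal[OF E(1)] power2_eq_square)
    have "norm ?p * norm ?p \<le> norm ?p * norm x"
      using px pp norm_cauchy_schwarz[of ?p x] by (simp add: power2_norm_eq_inner[symmetric] power2_eq_square)
    then have "norm ?p \<le> 1"
      using x by (cases "?p = 0") (auto simp: mult_le_cancel_left)
    then have bessel: "(\<Sum>c\<in>E. (x \<bullet> c)\<^sup>2) \<le> 1"
      unfolding pp[symmetric] by (simp add: dot_square_norm power_le_one)
    have "\<alpha> b \<le> \<alpha> b * (\<Sum>c\<in>E. (x \<bullet> c)\<^sup>2)"
      using mult_left_mono_neg[OF bessel neg] by simp
    also have "\<dots> \<le> (\<Sum>c\<in>E. \<alpha> c * (x \<bullet> c)\<^sup>2)"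
      unfolding sum_distrib_left using b(2) by (intro sum_mono mult_right_mono) auto
    also have "\<dots> = A x \<bullet> x"
      unfolding A inner_sum_left
      by (intro sum.cong refl) (simp add: inner_commute power2_eq_square)
    finally show "- (A x \<bullet> x) \<le> - \<alpha> b"
      by simp
  qed simp
  then show ?thesis
    using ge b(1) by (auto intro!: bexI[of _ b] antisym)
qed

section \<open>The step map\<close>

text \<open>For \<open>e\<close> in \<open>V\<close> this is \<open>|e|^2\<close> times the
  projection onto the complement of \<open>e\<close> in \<open>V\<close>; left unnormalised, it is
  polynomial and so continuous even where \<open>e = 0\<close>.\<close>

definition deflation :: "'a::real_inner \<Rightarrow> ('a \<Rightarrow>\<^sub>L 'a) \<Rightarrow> 'a \<Rightarrow>\<^sub>L 'a" where
  "deflation e P = (e \<bullet> e) *\<^sub>R P - outer e e"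

text \<open>The operator J of the overview: squeezing a skew \<open>K\<close> between two deflations
  keeps it skew and makes it kill \<open>e\<close>.\<close>

definition compression :: "('a::real_inner \<Rightarrow>\<^sub>L 'a) \<Rightarrow> 'a \<Rightarrow> ('a \<Rightarrow>\<^sub>L 'a) \<Rightarrow> 'a \<Rightarrow>\<^sub>L 'a" where
  "compression P e K = deflation e P o\<^sub>L K o\<^sub>L deflation e P"

text \<open>The coefficient r of the overview. The summand \<open>id_blinfun - P\<close> is the
  identity on the complement of \<open>V\<close>, so only injectivity of J + e e^T on
  \<open>V\<close> is tested.\<close>

definition regularity :: "('a::real_inner \<Rightarrow>\<^sub>L 'a) \<Rightarrow> 'a \<Rightarrow> ('a \<Rightarrow>\<^sub>L 'a) \<Rightarrow> real" where
  "regularity P e K = modulus (id_blinfun - P + compression P e K + outer e e)"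

definition raw_step ::
  "nat \<Rightarrow> ('a::real_inner \<Rightarrow>\<^sub>L 'a) \<Rightarrow> 'a \<Rightarrow> ('a \<Rightarrow>\<^sub>L 'a) \<Rightarrow> ('a \<Rightarrow>\<^sub>L 'a) \<Rightarrow> 'a \<Rightarrow>\<^sub>L 'a" where
  "raw_step n P e K A =
     (A o\<^sub>L A) + ((real n - 3) / (real n - 1) * low A) *\<^sub>R A
     + ((A o\<^sub>L compression P e K) - (compression P e K o\<^sub>L A)) + regularity P e K *\<^sub>R outer e e"

text \<open>As \<open>tr F P = n\<close>, the subtraction restores trace 0. The pair
  \<open>c\<close> holds a vector, projected to obtain \<open>e\<close>, and the operator
  \<open>K\<close>.\<close>

definition step ::
  "'a::real_inner set \<Rightarrow> nat \<Rightarrow> 'a \<times> ('a \<Rightarrow>\<^sub>L 'a) \<Rightarrow> ('a \<Rightarrow>\<^sub>L 'a) \<Rightarrow> ('a \<Rightarrow>\<^sub>L 'a) \<Rightarrow> 'a \<Rightarrow>\<^sub>L 'a" where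
  "step F n c P A = (let B = raw_step n P (P (fst c)) (snd c) A in B - (tr F B / real n) *\<^sub>R P)"

lemma continuous_on_compression:
  "continuous_on S f \<Longrightarrow> continuous_on S (\<lambda>P. compression P (f P) K)"
  unfolding compression_def deflation_def
  by (intro continuous_on_blinfun_compose continuous_on_diff continuous_on_scaleR continuous_on_inner
      continuous_on_outer continuous_on_id continuous_on_const)

lemma continuous_on_regularity:
  "continuous_on S f \<Longrightarrow> continuous_on S (\<lambda>P. regularity P (f P) K)"
  unfolding regularity_def
  by (intro continuous_on_modulus continuous_on_add continuous_on_diff continuous_on_compression
      continuous_on_outer continuous_on_id continuous_on_const)

lemma continuous_on_raw_step:
  assumes "continuous_on S f" "continuous_on S A"
  shows "continuous_on S (\<lambda>P. raw_step n P (f P) K (A P))"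
  unfolding raw_step_def
  by (intro continuous_on_add continuous_on_diff continuous_on_scaleR continuous_on_mult_left
      continuous_on_blinfun_compose continuous_on_low continuous_on_regularity continuous_on_compression
      continuous_on_outer assms)

lemma continuous_on_step:
  assumes "continuous_on S A"
  shows "continuous_on S (\<lambda>P. step F n c P (A P))"
proof -
  have "continuous_on S (\<lambda>P. blinfun_apply P (fst c))"
    by (intro continuous_intros)
  then have "continuous_on S (\<lambda>P. raw_step n P (P (fst c)) (snd c) (A P))" (is "continuous_on S ?B")
    using assms by (rule continuous_on_raw_step)
  then have "continuous_on S (\<lambda>P. ?B P - (inverse (real n) * tr F (?B P)) *\<^sub>R P)"
    by (intro continuous_on_diff continuous_on_scaleR continuous_on_mult_left continuous_on_tr continuous_on_id)
  then show ?thesis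
    by (simp add: step_def Let_def divide_inverse mult.commute)
qed

section \<open>One step over a fixed subspace\<close>

locale subspace_proj =
  fixes V :: "'a::real_inner set" and E0 F :: "'a set" and n :: nat and P :: "'a \<Rightarrow>\<^sub>L 'a"
  assumes E0: "orthonormal E0" "span E0 = V" "card E0 = n"
    and F: "orthonormal F" "V \<subseteq> span F"
    and n: "n \<ge> 3"
    and P_def: "P = orth_proj V"
begin

lemma subspace_V: "subspace V"
  using E0(2) subspace_span by blast

lemma P_in [simp]: "P x \<in> V"
  unfolding P_def by (rule orth_proj_in[OF E0(1,2)])

lemma P_id: "x \<in> V \<Longrightarrow> P x = x"
  unfolding P_def by (rule orth_proj_id[OF E0(1,2)])

lemma P_inner: "y \<in> V \<Longrightarrow> P x \<bullet> y = x \<bullet> y"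
  unfolding P_def by (rule orth_proj_inner[OF E0(1,2)])

lemma P_selfadjoint: "P x \<bullet> y = x \<bullet> P y"
  unfolding P_def by (rule orth_proj_selfadjoint[OF E0(1,2)])

lemma tr_P: "tr F P = n"
  unfolding P_def using tr_orth_proj[OF F E0(1,2)] E0(3) by simp

lemma E0_nonempty: "E0 \<noteq> {}"
  using E0(3) n by auto

lemma sphere_nonempty: "sphere (0::'a) 1 \<noteq> {}"
  using E0_nonempty orthonormal_norm[OF E0(1)] by (metis ex_in_conv mem_sphere_0)

lemma deflation_in: "e \<in> V \<Longrightarrow> deflation e P x \<in> V"
  by (simp add: deflation_def blinfun.diff_left blinfun.scaleR_left subspace_V subspace_diff subspace_scale)

lemma deflation_selfadjoint: "deflation e P x \<bullet> y = x \<bullet> deflation e P y"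
  using P_selfadjoint[of x y]
  by (simp add: deflation_def blinfun.diff_left blinfun.scaleR_left inner_diff_left inner_diff_right inner_commute)

lemma deflation_self: "e \<in> V \<Longrightarrow> deflation e P e = 0"
  by (simp add: deflation_def blinfun.diff_left blinfun.scaleR_left P_id)

lemma compression_in: "e \<in> V \<Longrightarrow> compression P e K x \<in> V"
  by (simp add: compression_def deflation_in)

lemma compression_skew:
  "skewadjoint K \<Longrightarrow> compression P e K x \<bullet> y = - (x \<bullet> compression P e K y)"
  by (simp add: compression_def deflation_selfadjoint skewadjoint_def)

lemma compression_self: "e \<in> V \<Longrightarrow> compression P e K e = 0"
  by (simp add: compression_def deflation_self blinfun.zero_right)

lemma regularity_nonneg: "regularity P e K \<ge> 0"
  unfolding regularity_def modulus_def using sphere_nonempty by (intro cINF_greatest) auto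

lemma regularity_posD:
  assumes "regularity P e K > 0" "x \<in> V" "compression P e K x + (e \<bullet> x) *\<^sub>R e = 0"
  shows "x = 0"
proof (rule ccontr)
  assume "x \<noteq> 0"
  let ?M = "id_blinfun - P + compression P e K + outer e e"
  let ?x = "x /\<^sub>R norm x"
  have "?M x = 0"
    using assms(2,3) by (simp add: blinfun.add_left blinfun.diff_left id_blinfun.rep_eq P_id)
  then have "?M ?x = 0"
    by (simp add: blinfun.scaleR_right)
  moreover have "regularity P e K \<le> norm (?M ?x)"
    unfolding regularity_def modulus_def
    using \<open>x \<noteq> 0\<close> by (intro cINF_lower bdd_belowI2[of _ 0]) auto
  ultimately show False
    using assms(1) by simp
qed

text \<open>J + e e^T vanishes on the orthogonal complement of \<open>V\<close>, maps
  \<open>V\<close> to itself and, by compactness, is bounded below on \<open>V\<close>. Together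
  with the identity on the complement, Pythagoras bounds the whole operator below.\<close>

lemma regularity_posI:
  assumes e: "e \<in> V" and inj: "\<And>x. x \<in> V \<Longrightarrow> compression P e K x + (e \<bullet> x) *\<^sub>R e = 0 \<Longrightarrow> x = 0"
  shows "regularity P e K > 0"
proof -
  let ?M = "id_blinfun - P + compression P e K + outer e e"
  define L where "L = compression P e K + outer e e"
  have L_in: "L x \<in> V" for x
    using e by (simp add: L_def blinfun.add_left compression_in subspace_V subspace_add subspace_scale)
  have M: "?M x = (x - P x) + L x" for x
    by (simp add: L_def blinfun.add_left blinfun.diff_left id_blinfun.rep_eq)
  let ?S = "V \<inter> sphere 0 1"
  have "compact ?S"
    using compact_span_sphere[OF E0(1)] E0 by simp
  moreover have "?S \<noteq> {}"
    using E0_nonempty E0(2) orthonormal_norm[OF E0(1)] span_base[of _ E0] by fastforce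
  moreover have "continuous_on ?S (\<lambda>x. norm (L x))"
    by (intro continuous_intros)
  ultimately obtain u where u: "u \<in> ?S" "\<And>x. x \<in> ?S \<Longrightarrow> norm (L u) \<le> norm (L x)"
    using continuous_attains_inf[of ?S "\<lambda>x. norm (L x)"] by metis
  have "L u = compression P e K u + (e \<bullet> u) *\<^sub>R e"
    by (simp add: L_def blinfun.add_left)
  then have "L u \<noteq> 0"
    using inj[of u] u(1) by (metis IntD1 IntD2 mem_sphere_0 norm_zero zero_neq_one)
  \<comment> \<open>Capped at 1, the bound on the complement, so that one constant serves both
    orthogonal parts.\<close>
  define c where "c = min 1 (norm (L u))"
  have c: "c > 0" "c \<le> 1" "c \<le> norm (L u)"
    using \<open>L u \<noteq> 0\<close> by (auto simp: c_def)
  have L_ge: "c * norm x \<le> norm (L x)" if "x \<in> V" for x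
  proof (cases "x = 0")
    case False
    then have "norm (L u) \<le> norm (L (x /\<^sub>R norm x))"
      using that by (intro u(2)) (simp add: subspace_V subspace_scale)
    then have "c \<le> norm (L x) / norm x"
      using c by (simp add: blinfun.scaleR_right field_simps)
    then show ?thesis
      using False by (simp add: field_simps)
  qed simp
  have "c \<le> norm (?M x)" if "x \<in> sphere 0 1" for x
  proof -
    let ?w = "x - P x"
    have w: "?w \<bullet> y = 0" if "y \<in> V" for y
      using P_inner[OF that] by (simp add: inner_diff_left)
    have LL: "L x = L (P x)"
    proof -
      have "L ?w = 0"
      proof -
        have e0: "e \<bullet> ?w = 0"
          using w[OF e] by (simp add: inner_commute)
        then have "deflation e P ?w = 0"
          by (simp add: deflation_def blinfun.diff_left blinfun.scaleR_left blinfun.diff_right P_id inner_diff_right)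
        then show ?thesis
          using e0 by (simp add: L_def blinfun.add_left compression_def blinfun.zero_right)
      qed
      then show ?thesis
        by (simp add: blinfun.diff_right)
    qed
    have "(norm (?w + L x))\<^sup>2 = (norm ?w)\<^sup>2 + (norm (L x))\<^sup>2"
      using w[OF L_in[of x]] by (intro norm_add_Pythagorean) (simp add: orthogonal_def)
    also have "(norm (L x))\<^sup>2 \<ge> (c * norm (P x))\<^sup>2"
      unfolding LL using L_ge[of "P x"] c by (intro power_mono) auto
    moreover have "(norm ?w)\<^sup>2 \<ge> c\<^sup>2 * (norm ?w)\<^sup>2"
      using c by (intro mult_left_le_one_le) (auto simp: power_le_one)
    moreover have "(norm x)\<^sup>2 = (norm ?w)\<^sup>2 + (norm (P x))\<^sup>2"
      using norm_add_Pythagorean[of ?w "P x"] w[of "P x"] by (simp add: orthogonal_def)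
    ultimately have "c\<^sup>2 * (norm x)\<^sup>2 \<le> (norm (?w + L x))\<^sup>2"
      by (simp add: algebra_simps power_mult_distrib)
    then have "c\<^sup>2 \<le> (norm (?M x))\<^sup>2"
      using that M by simp
    then show ?thesis
      by (rule power2_le_imp_le) simp
  qed
  then have "c \<le> regularity P e K"
    unfolding regularity_def modulus_def using sphere_nonempty by (intro cINF_greatest) auto
  then show ?thesis
    using c by simp
qed

definition traceless_on :: "('a \<Rightarrow>\<^sub>L 'a) \<Rightarrow> bool" where
  "traceless_on A \<longleftrightarrow> selfadjoint A \<and> (\<forall>x. A x \<in> V) \<and> tr F A = 0"

lemma traceless_spectral:
  assumes "traceless_on A"
  obtains E \<alpha> where "orthonormal E" "span E = V" "card E = n" "\<And>b. b \<in> E \<Longrightarrow> A b = \<alpha> b *\<^sub>R b"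
    "\<And>x. A x = (\<Sum>b\<in>E. (\<alpha> b * (x \<bullet> b)) *\<^sub>R b)" "sum \<alpha> E = 0"
    "\<forall>b\<in>E. - low A \<le> \<alpha> b" "\<exists>b\<in>E. \<alpha> b = - low A"
proof -
  obtain E \<alpha> where E: "orthonormal E" "span E = V" "card E = n" "\<And>b. b \<in> E \<Longrightarrow> A b = \<alpha> b *\<^sub>R b"
    "\<And>x. A x = (\<Sum>b\<in>E. (\<alpha> b * (x \<bullet> b)) *\<^sub>R b)"
    using spectral_expansion[OF E0(1,2), of A] assms E0(3) by (auto simp: traceless_on_def)
  have "E \<subseteq> span F"
    using E(2) F(2) span_superset by blast
  then have s: "sum \<alpha> E = 0"
    using tr_spectral[OF F(1) _ E(1,5)] assms by (simp add: traceless_on_def)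
  have "E \<noteq> {}"
    using E(3) n by auto
  then show ?thesis
    using that[OF E s] low_spectral[OF E(1) _ E(5) s] by blast
qed

text \<open>Comparing matrix entries in an eigenbasis of \<open>A\<close> produces an instance of
  \<open>rank_one_system\<close>, where \<open>r > 0\<close> is impossible and \<open>r = 0\<close>
  forces all eigenvalues to be 0.\<close>

lemma raw_step_not_scalar:
  assumes A: "traceless_on A" and K: "skewadjoint K" and e: "e \<in> V"
    and scalar: "\<And>x. x \<in> V \<Longrightarrow> raw_step n P e K A x = l *\<^sub>R x"
  shows "A = 0 \<and> regularity P e K = 0"
proof -
  let ?J = "compression P e K"
  let ?r = "regularity P e K"
  obtain E \<alpha> where E: "orthonormal E" "span E = V" "card E = n" "\<And>b. b \<in> E \<Longrightarrow> A b = \<alpha> b *\<^sub>R b"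
    "\<And>x. A x = (\<Sum>b\<in>E. (\<alpha> b * (x \<bullet> b)) *\<^sub>R b)" "sum \<alpha> E = 0"
    "\<forall>b\<in>E. - low A \<le> \<alpha> b" "\<exists>b\<in>E. \<alpha> b = - low A"
    using traceless_spectral[OF A] by blast
  have EV: "b \<in> V" if "b \<in> E" for b
    using that E(2) span_base by blast
  have Ainner: "A x \<bullet> b = \<alpha> b * (x \<bullet> b)" if "b \<in> E" for x b
    using A E(4)[OF that] by (simp add: traceless_on_def selfadjoint_def)
  have eq: "(\<alpha> b)\<^sup>2 * (b \<bullet> c) + (real n - 3) / (real n - 1) * low A * \<alpha> b * (b \<bullet> c)
      + (\<alpha> c - \<alpha> b) * (?J b \<bullet> c) + ?r * (e \<bullet> b) * (e \<bullet> c) = l * (b \<bullet> c)"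
    if "b \<in> E" "c \<in> E" for b c
  proof -
    have "raw_step n P e K A b \<bullet> c = l * (b \<bullet> c)"
      using scalar[OF EV[OF that(1)]] by simp
    then show ?thesis
      using that
      by (simp add: raw_step_def blinfun.add_left blinfun.diff_left blinfun.scaleR_left Ainner E(4)
          blinfun.scaleR_right inner_add_left inner_diff_left algebra_simps power2_eq_square)
  qed
  interpret rank_one_system E n \<alpha> "\<lambda>b. e \<bullet> b" "\<lambda>b c. ?J b \<bullet> c" "low A" ?r l
  proof
    show "finite E" "card E = n" "n \<ge> 3"
      using E n orthonormal_finite by auto
    show "?J b \<bullet> c = - (?J c \<bullet> b)" for b c
      using compression_skew[OF K, of e b c] by (simp add: inner_commute)
    show "(\<Sum>c\<in>E. (?J b \<bullet> c) * (e \<bullet> c)) = 0" for b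
      using orthonormal_inner_expansion[OF E(1), of "?J b" e] compression_in[OF e, of K b] E(2)
        compression_skew[OF K, of e b e] compression_self[OF e, of K] by simp
    show "(\<alpha> b)\<^sup>2 + (real n - 3) / (real n - 1) * low A * \<alpha> b + ?r * (e \<bullet> b)\<^sup>2 = l" if "b \<in> E" for b
      using eq[OF that that] E(1) that by (simp add: orthonormal_inner power2_eq_square)
    show "(\<alpha> c - \<alpha> b) * (?J b \<bullet> c) + ?r * (e \<bullet> b) * (e \<bullet> c) = 0" if "b \<in> E" "c \<in> E" "b \<noteq> c" for b c
      using eq[OF that(1,2)] E(1) that by (simp add: orthonormal_inner)
    \<comment> \<open>If \<open>e = 0\<close>, then J + e e^T is zero; if \<open>b\<close> is
      orthogonal to \<open>e\<close> and J b = 0, then \<open>b\<close> is in its kernel. Both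
      contradict \<open>regularity_posD\<close>.\<close>
    show "(\<exists>b\<in>E. e \<bullet> b \<noteq> 0) \<and> (\<forall>b\<in>E. e \<bullet> b = 0 \<longrightarrow> (\<exists>c\<in>E. ?J b \<bullet> c \<noteq> 0))" if r: "0 < ?r"
    proof (intro conjI ballI impI; rule ccontr)
      assume "\<not> (\<exists>b\<in>E. e \<bullet> b \<noteq> 0)"
      then have "e = 0"
        using e E(2) by (intro orthonormal_span_eqI[OF E(1)]) (auto simp: span_zero)
      have "E \<noteq> {}"
        using E(3) n by auto
      then obtain b where "b \<in> E"
        by blast
      then have "b = 0"
        using regularity_posD[OF r EV] \<open>e = 0\<close>
        by (simp add: compression_def deflation_def blinfun.diff_left blinfun.minus_left blinfun.scaleR_left)
      then show False
        using orthonormal_norm[OF E(1) \<open>b \<in> E\<close>] by simp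
    next
      fix b assume b: "b \<in> E" "e \<bullet> b = 0" "\<not> (\<exists>c\<in>E. ?J b \<bullet> c \<noteq> 0)"
      then have "?J b = 0"
        using compression_in[OF e, of K b] E(2)
        by (intro orthonormal_span_eqI[OF E(1)]) (auto simp: span_zero)
      then have "b = 0"
        using regularity_posD[OF r EV[OF b(1)]] b(2) by simp
      then show False
        using orthonormal_norm[OF E(1) b(1)] by simp
    qed
  qed (use E(6-8) regularity_nonneg in auto)
  have "?r = 0"
    using no_regular_zero regularity_nonneg[of e K] by simp
  moreover have "A x = 0" for x
    using no_rank_one_part \<open>?r = 0\<close> by (simp add: E(5))
  ultimately show ?thesis
    by (simp add: blinfun_eqI)
qed

text \<open>The commutator of a selfadjoint and a skew operator is selfadjoint.\<close>

lemma step_traceless: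
  assumes A: "traceless_on A" and K: "skewadjoint (snd c)"
  shows "traceless_on (step F n c P A)"
proof -
  define B where "B = raw_step n P (P (fst c)) (snd c) A"
  define J where "J = compression P (P (fst c)) (snd c)"
  have step: "step F n c P A = B - (tr F B / real n) *\<^sub>R P"
    by (simp add: step_def B_def Let_def)
  have sa: "A x \<bullet> y = x \<bullet> A y" and Jsk: "J x \<bullet> y = - (x \<bullet> J y)" for x y
    using A compression_skew[OF K] by (simp_all add: traceless_on_def selfadjoint_def J_def)
  have "B x \<bullet> y = x \<bullet> B y" for x y
    unfolding B_def raw_step_def J_def[symmetric]
    by (simp add: blinfun.add_left blinfun.diff_left blinfun.scaleR_left inner_add_left inner_add_right
        inner_diff_left inner_diff_right sa Jsk inner_commute[of x "P (fst c)"])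
  then have "selfadjoint (step F n c P A)"
    by (simp add: selfadjoint_def step blinfun.diff_left blinfun.scaleR_left inner_diff_left inner_diff_right P_selfadjoint)
  moreover have "B x \<in> V" for x
    using A compression_in[of "P (fst c)" "snd c"] subspace_V
    by (auto simp: B_def raw_step_def blinfun.add_left blinfun.diff_left blinfun.scaleR_left traceless_on_def
        intro!: subspace_add subspace_diff subspace_scale)
  then have "step F n c P A x \<in> V" for x
    by (simp add: step blinfun.diff_left blinfun.scaleR_left subspace_V subspace_diff subspace_scale)
  moreover have "tr F (step F n c P A) = 0"
    using n by (simp add: step tr_diff tr_scaleR tr_P)
  ultimately show ?thesis
    by (simp add: traceless_on_def)
qed

lemma step_eq_0D:
  assumes "traceless_on A" "skewadjoint (snd c)" "step F n c P A = 0"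
  shows "A = 0 \<and> regularity P (P (fst c)) (snd c) = 0"
proof (rule raw_step_not_scalar[OF assms(1,2)])
  let ?B = "raw_step n P (P (fst c)) (snd c) A"
  fix x assume "x \<in> V"
  have "?B = (tr F ?B / real n) *\<^sub>R P"
    using assms(3) by (simp add: step_def Let_def)
  then have "?B x = ((tr F ?B / real n) *\<^sub>R P) x"
    by simp
  then show "?B x = (tr F ?B / real n) *\<^sub>R x"
    using P_id[OF \<open>x \<in> V\<close>] by (simp add: blinfun.scaleR_left)
qed simp

end

section \<open>Iterating the step\<close>

definition iterate_step :: "'a::real_inner set \<Rightarrow> nat \<Rightarrow> ('a \<times> ('a \<Rightarrow>\<^sub>L 'a)) list \<Rightarrow> ('a \<Rightarrow>\<^sub>L 'a) \<Rightarrow> 'a \<Rightarrow>\<^sub>L 'a" where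
  "iterate_step F n cs P = foldr (\<lambda>c. step F n c P) cs 0"

lemma continuous_on_iterate_step: "continuous_on S (iterate_step F n cs)"
proof (induction cs)
  case (Cons c cs)
  then show ?case
    using continuous_on_step[of S "iterate_step F n cs" F n c] by (simp add: iterate_step_def[abs_def])
qed (simp add: iterate_step_def[abs_def])

context subspace_proj
begin

lemma iterate_step_traceless:
  "(\<And>c. c \<in> set cs \<Longrightarrow> skewadjoint (snd c)) \<Longrightarrow> traceless_on (iterate_step F n cs P)"
proof (induction cs)
  case Nil
  then show ?case
    by (simp add: iterate_step_def traceless_on_def selfadjoint_def tr_def subspace_0 subspace_V)
next
  case (Cons c cs)
  then show ?case
    using step_traceless[of "iterate_step F n cs P" c] by (simp add: iterate_step_def)
qed

text \<open>If the head chart is regular, its step is nonzero whatever it is applied to; otherwise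
  the tail already gives a nonzero operator and the step keeps it so.\<close>

lemma iterate_step_nonzero:
  "(\<And>c. c \<in> set cs \<Longrightarrow> skewadjoint (snd c)) \<Longrightarrow>
   \<exists>c\<in>set cs. regularity P (P (fst c)) (snd c) > 0 \<Longrightarrow> iterate_step F n cs P \<noteq> 0"
proof (induction cs)
  case (Cons d cs)
  have s: "iterate_step F n (d # cs) P = step F n d P (iterate_step F n cs P)"
    by (simp add: iterate_step_def)
  show ?case
  proof
    assume "iterate_step F n (d # cs) P = 0"
    then have "iterate_step F n cs P = 0 \<and> regularity P (P (fst d)) (snd d) = 0"
      using step_eq_0D[of "iterate_step F n cs P" d] iterate_step_traceless[of cs] Cons.prems(1) s by simp
    then show False
      using Cons by auto
  qed
qed simp

end

section \<open>Charts and ellipsoids\<close>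

text \<open>
  A chart is given by an \<open>n\<close>-tuple \<open>vs\<close> of vectors of an orthonormal basis of \<open>\<real>\<^sup>N\<close>; it is usable at those
  \<open>V\<close> onto which the tuple projects as a basis. The first vector yields \<open>e\<close> and the remaining \<open>n - 1\<close>
  are paired off by \<open>partner\<close> to yield \<open>J\<close>.
\<close>
definition partner :: "nat \<Rightarrow> nat" where
  "partner j = (if odd j then j + 1 else j - 1)"

definition chart :: "nat \<Rightarrow> 'a::real_inner list \<Rightarrow> 'a \<times> ('a \<Rightarrow>\<^sub>L 'a)" where
  "chart n vs =
     (vs ! 0, \<Sum>j\<in>{1..<n}. (if odd j then 1 else - 1) *\<^sub>R outer (vs ! j) (vs ! partner j))"

text \<open>This is where \<open>n\<close> must be odd: the indices 1 to \<open>n - 1\<close> then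
  split exactly into the pairs (1,2), (3,4), and so on.\<close>

lemma partner_in: "odd n \<Longrightarrow> j \<in> {1..<n} \<Longrightarrow> partner j \<in> {1..<n}"
  by (auto simp: partner_def elim!: oddE evenE)

lemma partner_partner: "j \<ge> 1 \<Longrightarrow> partner (partner j) = j"
  by (auto simp: partner_def)

lemma odd_partner: "j \<ge> 1 \<Longrightarrow> odd (partner j) \<longleftrightarrow> even j"
  by (auto simp: partner_def)

lemma chart_apply:
  "snd (chart n vs) x = (\<Sum>j\<in>{1..<n}. ((if odd j then 1 else - 1) * (vs ! partner j \<bullet> x)) *\<^sub>R (vs ! j))"
  by (simp add: chart_def blinfun.sum_left blinfun.scaleR_left)

text \<open>\<open>partner\<close> is an involution that flips the sign, so reindexing along it
  exchanges \<open>x\<close> and \<open>y\<close> at the cost of a minus sign.\<close>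

lemma chart_skew:
  assumes "odd n"
  shows "skewadjoint (snd (chart n vs))"
  unfolding skewadjoint_def
proof (intro allI)
  fix x y :: 'a
  let ?g = "\<lambda>j. if odd j then 1 else - 1 :: real"
  have "snd (chart n vs) x \<bullet> y = (\<Sum>j\<in>{1..<n}. ?g j * (vs ! partner j \<bullet> x) * (vs ! j \<bullet> y))"
    unfolding chart_apply inner_sum_left by (intro sum.cong refl) simp
  also have "\<dots> = (\<Sum>j\<in>{1..<n}. ?g (partner j) * (vs ! j \<bullet> x) * (vs ! partner j \<bullet> y))"
    by (rule sum.reindex_bij_witness[of _ partner partner])
      (use partner_in[OF assms] in \<open>auto simp: partner_partner\<close>)
  also have "\<dots> = (\<Sum>j\<in>{1..<n}. - (?g j * (vs ! partner j \<bullet> y) * (x \<bullet> vs ! j)))"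
    by (intro sum.cong refl) (auto simp: odd_partner inner_commute)
  also have "\<dots> = - (x \<bullet> snd (chart n vs) y)"
    unfolding chart_apply inner_sum_right sum_negf by simp
  finally show "snd (chart n vs) x \<bullet> y = - (x \<bullet> snd (chart n vs) y)" .
qed

lemma independent_family_zero:
  fixes b :: "'i \<Rightarrow> 'a::real_vector"
  assumes "finite I" "inj_on b I" "independent (b ` I)" "(\<Sum>i\<in>I. u i *\<^sub>R b i) = 0" "i \<in> I"
  shows "u i = 0"
proof -
  let ?u = "\<lambda>v. u (the_inv_into I b v)"
  have "(\<Sum>v\<in>b ` I. ?u v *\<^sub>R v) = (\<Sum>i\<in>I. u i *\<^sub>R b i)"
    using assms(2) by (simp add: sum.reindex the_inv_into_f_f)
  then have "?u (b i) = 0"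
    using assms by (intro independentD[OF assms(3), of "b ` I" ?u]) auto
  then show ?thesis
    using assms(2,5) by (simp add: the_inv_into_f_f)
qed

context subspace_proj
begin

text \<open>Pairing the equation with \<open>e\<close> shows that \<open>x\<close> is orthogonal to
  \<open>e\<close>. Then \<open>?D (?K x) = 0\<close>, and expanding this in the basis
  \<open>b\<close> shows that every \<open>vs ! j\<close> with \<open>0 < j < n\<close> is
  orthogonal to \<open>x\<close>. So \<open>x\<close> is orthogonal to a spanning set of
  \<open>V\<close>.\<close>

lemma chart_regular:
  assumes n_odd: "odd n" and b: "\<And>j. j < n \<Longrightarrow> P (vs ! j) = b j"
    and inj: "inj_on b {..<n}" and ind: "independent (b ` {..<n})" and sp: "span (b ` {..<n}) = V"
  shows "regularity P (P (fst (chart n vs))) (snd (chart n vs)) > 0"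
proof (rule regularity_posI)
  let ?K = "snd (chart n vs)"
  let ?g = "\<lambda>j. if odd j then 1 else - 1 :: real"
  define e where "e = P (fst (chart n vs))"
  have eb: "e = b 0"
    using n b[of 0] by (simp add: e_def chart_def)
  have eV: "e \<in> V"
    by (simp add: e_def)
  then show "P (fst (chart n vs)) \<in> V"
    by (simp add: e_def)
  have "b 0 \<noteq> 0"
    using ind n by (metis dependent_zero imageI lessThan_iff not_numeral_le_zero gr0I)
  then have ee: "e \<bullet> e \<noteq> 0"
    by (simp add: eb)
  fix x assume x: "x \<in> V"
    and zero: "compression P (P (fst (chart n vs))) ?K x + (P (fst (chart n vs)) \<bullet> x) *\<^sub>R P (fst (chart n vs)) = 0"
  let ?D = "deflation e P"
  have zero': "compression P e ?K x + (e \<bullet> x) *\<^sub>R e = 0"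
    using zero by (simp add: e_def)
  have "compression P e ?K x \<bullet> e = 0"
    using compression_skew[OF chart_skew[OF n_odd], of e vs x e] compression_self[OF eV] by simp
  then have "(e \<bullet> x) * (e \<bullet> e) = 0"
    using arg_cong[OF zero', of "\<lambda>y. y \<bullet> e"] by (simp add: inner_add_left)
  then have ex: "e \<bullet> x = 0"
    using ee by simp
  have Dx: "?D x = (e \<bullet> e) *\<^sub>R x"
    using ex P_id[OF x] by (simp add: deflation_def blinfun.diff_left blinfun.scaleR_left)
  have "(e \<bullet> e) *\<^sub>R ?D (?K x) = 0"
    using zero' ex by (simp add: compression_def Dx blinfun.scaleR_right)
  then have DK: "?D (?K x) = 0"
    using ee by simp
  define c where "c j = ?g j * (vs ! partner j \<bullet> x)" for j
  \<comment> \<open>The coordinates of \<open>?D (?K x)\<close> in the basis \<open>b\<close>; the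
    multiples of \<open>e = b 0\<close> subtracted by the deflation are collected at index
    0.\<close>
  define u where "u j = (if j = 0 then - (\<Sum>i\<in>{1..<n}. c i * (e \<bullet> vs ! i)) else (e \<bullet> e) * c j)" for j
  have split: "{..<n} = insert 0 {1..<n}"
    using n by auto
  have "(\<Sum>j<n. u j *\<^sub>R b j) = u 0 *\<^sub>R e + (\<Sum>j\<in>{1..<n}. u j *\<^sub>R b j)"
    unfolding split eb by (subst sum.insert) auto
  also have "\<dots> = (\<Sum>j\<in>{1..<n}. ((e \<bullet> e) * c j) *\<^sub>R b j) - (\<Sum>j\<in>{1..<n}. (c j * (e \<bullet> vs ! j)) *\<^sub>R e)"
    by (simp add: u_def scaleR_sum_left)
  also have "\<dots> = (\<Sum>j\<in>{1..<n}. c j *\<^sub>R ?D (vs ! j))"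
    unfolding sum_subtractf[symmetric]
    by (intro sum.cong refl)
      (simp add: deflation_def blinfun.diff_left blinfun.scaleR_left scaleR_diff_right b mult.commute)
  also have "\<dots> = ?D (?K x)"
    by (simp add: chart_apply blinfun.sum_right blinfun.scaleR_right c_def)
  finally have usum: "(\<Sum>j<n. u j *\<^sub>R b j) = 0"
    using DK by simp
  have c0: "c j = 0" if "j \<in> {1..<n}" for j
    using independent_family_zero[OF _ inj ind usum, of j] that ee by (auto simp: u_def)
  have pv: "vs ! partner j \<bullet> x = 0" if "j \<in> {1..<n}" for j
    using c0[OF that] by (simp add: c_def split: if_splits)
  have vx: "vs ! j \<bullet> x = 0" if "j \<in> {1..<n}" for j
    using pv[OF partner_in[OF n_odd that]] partner_partner[of j] that by simp
  have "orthogonal x y" if y: "y \<in> b ` {..<n}" for y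
  proof -
    obtain j where j: "j < n" "y = b j"
      using y by blast
    show ?thesis
    proof (cases "j = 0")
      case True
      then show ?thesis
        using j ex eb by (simp add: orthogonal_def inner_commute)
    next
      case False
      then show ?thesis
        using j vx[of j] P_inner[OF x, of "vs ! j"] b[of j]
        by (simp add: orthogonal_def inner_commute)
    qed
  qed
  then have "orthogonal x x"
    using x sp orthogonal_to_span[of x "b ` {..<n}" x] by blast
  then show "x = 0"
    by (simp add: orthogonal_def)
qed

text \<open>\<open>P\<close> maps \<open>span F\<close> onto \<open>V\<close>, so the projections of
  \<open>F\<close> span \<open>V\<close>; a maximal independent family of them lifts back to an
  \<open>n\<close>-tuple in \<open>F\<close>.\<close>

lemma ex_regular_chart:
  assumes "odd n"
  shows "\<exists>vs. set vs \<subseteq> F \<and> length vs = n \<and>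
           regularity P (P (fst (chart n vs))) (snd (chart n vs)) > 0"
proof -
  obtain B where B: "B \<subseteq> P ` F" "independent B" "P ` F \<subseteq> span B"
    using maximal_independent_subset by blast
  have "span B = V"
  proof (rule antisym)
    show "span B \<subseteq> V"
      using B(1) by (intro span_minimal subspace_V) (auto dest!: subsetD)
    show "V \<subseteq> span B"
    proof
      fix x assume x: "x \<in> V"
      have "P x \<in> P ` span F"
        using x F(2) by blast
      also have "P ` span F = span (P ` F)"
        by (rule span_linear_image[symmetric]) (rule bounded_linear.linear[OF blinfun.bounded_linear_right])
      also have "\<dots> \<subseteq> span B"
        using B(3) by (intro span_minimal subspace_span)
      finally show "x \<in> span B"
        using P_id[OF x] by simp
    qed
  qed
  have "finite B"
    using B(1) orthonormal_finite[OF F(1)] by (meson finite_imageI finite_subset)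
  moreover have "card B = n"
    using dim_span_eq_card_independent[OF B(2)] orthonormal_dim[OF E0(1)] E0 \<open>span B = V\<close> by simp
  ultimately obtain xs where xs: "set xs = B" "distinct xs" "length xs = n"
    using finite_distinct_list distinct_card by metis
  obtain g where g: "\<And>b. b \<in> B \<Longrightarrow> g b \<in> F \<and> P (g b) = b"
    using B(1) by (metis (no_types, lifting) image_iff subsetD)
  let ?vs = "map g xs"
  have img: "(!) xs ` {..<n} = B"
    using xs by (auto simp: set_conv_nth)
  have "regularity P (P (fst (chart n ?vs))) (snd (chart n ?vs)) > 0"
  proof (rule chart_regular[OF assms])
    show "P (?vs ! j) = xs ! j" if "j < n" for j
      using g xs that by auto
    show "inj_on ((!) xs) {..<n}"
      using xs by (auto simp: inj_on_def nth_eq_iff_index_eq)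
  qed (use img B(2) \<open>span B = V\<close> in auto)
  moreover have "set ?vs \<subseteq> F" "length ?vs = n"
    using g xs by auto
  ultimately show ?thesis
    by blast
qed

end

section \<open>Ellipsoids and their comparison with balls\<close>

locale ellipsoid =
  fixes V E :: "'a::real_inner set" and T :: "'a \<Rightarrow>\<^sub>L 'a" and \<beta> :: "'a \<Rightarrow> real"
  assumes E: "orthonormal E" "span E = V"
    and eig: "\<And>b. b \<in> E \<Longrightarrow> T b = \<beta> b *\<^sub>R b"
    and ge1: "\<And>b. b \<in> E \<Longrightarrow> \<beta> b \<ge> 1"
    and one: "\<exists>b\<in>E. \<beta> b = 1" and two: "\<exists>b\<in>E. \<beta> b \<ge> 2"
begin

abbreviation "B \<equiv> T ` (V \<inter> cball 0 1)"

lemma subspace_V: "subspace V"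
  using E subspace_span by blast

lemma E_in: "b \<in> E \<Longrightarrow> b \<in> V"
  using E span_base by blast

lemma T_expansion: "x \<in> V \<Longrightarrow> T x = (\<Sum>b\<in>E. (\<beta> b * (x \<bullet> b)) *\<^sub>R b)"
proof -
  assume "x \<in> V"
  then have "T x = T (\<Sum>b\<in>E. (x \<bullet> b) *\<^sub>R b)"
    using orthonormal_expansion[OF E(1)] E(2) by simp
  then show ?thesis
    by (simp add: blinfun.sum_right blinfun.scaleR_right eig mult.commute)
qed

lemma T_inner: "x \<in> V \<Longrightarrow> b \<in> E \<Longrightarrow> T x \<bullet> b = \<beta> b * (x \<bullet> b)"
  by (simp add: T_expansion inner_sum_orthonormal[OF E(1)])

lemma body_subset: "B \<subseteq> V"
  by (auto simp: T_expansion E_in intro!: subspace_sum subspace_scale subspace_V)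

lemma compact_body: "compact B"
  using compact_span_cball[OF E(1)] E(2)
  by (intro compact_continuous_image) (auto intro: continuous_intros)

lemma convex_body_set: "convex B"
  using subspace_V
  by (intro convex_linear_image convex_Int subspace_imp_convex convex_cball bounded_linear.linear[OF blinfun.bounded_linear_right])

lemma uminus_body: "uminus ` B = B"
proof -
  have sub: "uminus ` B \<subseteq> B"
  proof
    fix y assume "y \<in> uminus ` B"
    then obtain x where "x \<in> V \<inter> cball 0 1" "y = T (- x)"
      by (auto simp: blinfun.minus_right)
    then show "y \<in> B"
      by (auto simp: subspace_V subspace_neg)
  qed
  have "uminus ` (uminus ` B) \<subseteq> uminus ` B"
    using sub by (rule image_mono)
  then show ?thesis
    using sub by (auto simp: image_image)
qed

text \<open>Dividing coordinates by eigenvalues at least 1 does not lengthen a vector, so the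
  preimage lies in the unit ball. This gives the body its interior points.\<close>

lemma cball_subset_body: "V \<inter> cball 0 1 \<subseteq> B"
proof
  fix x assume x: "x \<in> V \<inter> cball 0 1"
  define y where "y = (\<Sum>b\<in>E. ((x \<bullet> b) / \<beta> b) *\<^sub>R b)"
  have yV: "y \<in> V"
    unfolding y_def using E_in by (intro subspace_sum subspace_scale subspace_V) auto
  have yb: "y \<bullet> b = (x \<bullet> b) / \<beta> b" if "b \<in> E" for b
    unfolding y_def by (rule inner_sum_orthonormal[OF E(1) that])
  have "T y = x"
  proof (rule orthonormal_span_eqI[OF E(1)])
    show "T y \<in> span E" "x \<in> span E"
      using yV x body_subset E(2) E_in
      by (auto simp: T_expansion intro!: span_sum span_scale intro: span_base)
    show "T y \<bullet> b = x \<bullet> b" if "b \<in> E" for b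
      using ge1[OF that] by (simp add: T_inner yV that yb)
  qed
  moreover have "y \<bullet> y \<le> x \<bullet> x"
  proof -
    have "y \<bullet> y = (\<Sum>b\<in>E. (y \<bullet> b)\<^sup>2)"
      using orthonormal_inner_expansion[OF E(1), of y y] yV E(2) by (simp add: power2_eq_square)
    also have "\<dots> \<le> (\<Sum>b\<in>E. (x \<bullet> b)\<^sup>2)"
    proof (rule sum_mono)
      fix b assume b: "b \<in> E"
      have "\<bar>x \<bullet> b\<bar> / \<beta> b \<le> \<bar>x \<bullet> b\<bar> / 1"
        using ge1[OF b] by (intro divide_left_mono) auto
      then have "\<bar>y \<bullet> b\<bar> \<le> \<bar>x \<bullet> b\<bar>"
        using ge1[OF b] by (simp add: yb[OF b] abs_divide)
      then show "(y \<bullet> b)\<^sup>2 \<le> (x \<bullet> b)\<^sup>2"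
        by (simp add: abs_le_square_iff)
    qed
    also have "\<dots> = x \<bullet> x"
      using orthonormal_inner_expansion[OF E(1), of x x] x E(2) by (simp add: power2_eq_square)
    finally show ?thesis .
  qed
  then have "norm y \<le> 1"
    using x by (auto simp: norm_le[symmetric])
  ultimately show "x \<in> B"
    using yV by (intro image_eqI[of _ _ y]) auto
qed

text \<open>Only widths are compared, so the centre does not matter: along \<open>w\<close> the ball
  contains a chord of length at least \<open>4 s\<close>, so \<open>2 s <= r\<close>; along
  \<open>v\<close> it fits in a slab of half-width \<open>t\<close>, so
  \<open>r <= t\<close>.\<close>

lemma ball_ratio:
  assumes c: "c \<in> V" and r: "r > 0" and st: "s > 0" "t > 0"
    and inner: "(*\<^sub>R) s ` B \<subseteq> cball c r \<inter> V" and outer: "cball c r \<inter> V \<subseteq> (*\<^sub>R) t ` B"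
  shows "2 \<le> t / s"
proof -
  obtain v w where v: "v \<in> E" "\<beta> v = 1" and w: "w \<in> E" "\<beta> w \<ge> 2"
    using one two by blast
  have wB: "a *\<^sub>R (\<beta> w *\<^sub>R w) \<in> B" if "\<bar>a\<bar> = 1" for a
  proof -
    have "a *\<^sub>R (\<beta> w *\<^sub>R w) = T (a *\<^sub>R w)"
      by (simp add: blinfun.scaleR_right eig w)
    moreover have "a *\<^sub>R w \<in> V \<inter> cball 0 1"
      using that w by (simp add: subspace_V subspace_scale E_in orthonormal_norm[OF E(1)])
    ultimately show ?thesis
      by blast
  qed
  let ?z = "(s * \<beta> w) *\<^sub>R w"
  have "s *\<^sub>R (a *\<^sub>R (\<beta> w *\<^sub>R w)) \<in> cball c r" if "\<bar>a\<bar> = 1" for a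
    using inner wB[OF that] by blast
  from this[of 1] this[of "-1"] have "?z \<in> cball c r" "- ?z \<in> cball c r"
    by simp_all
  then have "dist c ?z \<le> r" "dist c (- ?z) \<le> r"
    by simp_all
  then have "dist ?z (- ?z) \<le> 2 * r"
    using dist_triangle3[of ?z "- ?z" c] by linarith
  moreover have "dist ?z (- ?z) = 2 * (s * \<beta> w)"
  proof -
    have "?z - (- ?z) = (2 * (s * \<beta> w)) *\<^sub>R w"
      by (metis diff_minus_eq_add scaleR_2 scaleR_scaleR)
    then show ?thesis
      using st w by (simp add: dist_norm orthonormal_norm[OF E(1)])
  qed
  ultimately have "s * \<beta> w \<le> r"
    by simp
  moreover have "s * 2 \<le> s * \<beta> w"
    using st w by simp
  ultimately have s: "2 * s \<le> r"
    by simp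
  have vt: "\<bar>y \<bullet> v\<bar> \<le> t" if y: "y \<in> cball c r \<inter> V" for y
  proof -
    obtain x where x: "x \<in> V \<inter> cball 0 1" "y = t *\<^sub>R T x"
      using outer y by blast
    have "y \<bullet> v = t * (x \<bullet> v)"
      using x v by (simp add: T_inner)
    moreover have "\<bar>x \<bullet> v\<bar> \<le> 1"
      using Cauchy_Schwarz_ineq2[of x v] x orthonormal_norm[OF E(1) v(1)] by simp
    ultimately show ?thesis
      using st by (simp add: abs_mult)
  qed
  have "c + a *\<^sub>R v \<in> cball c r \<inter> V" if "\<bar>a\<bar> \<le> r" for a
    using that c v by (simp add: dist_norm orthonormal_norm[OF E(1)] subspace_V subspace_add subspace_scale E_in)
  then have "\<bar>(c + a *\<^sub>R v) \<bullet> v\<bar> \<le> t" if "\<bar>a\<bar> \<le> r" for a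
    using vt that by blast
  moreover have "(c + a *\<^sub>R v) \<bullet> v = c \<bullet> v + a" for a
    using v E(1) by (simp add: orthonormal_inner inner_add_left)
  ultimately have "\<bar>c \<bullet> v + a\<bar> \<le> t" if "\<bar>a\<bar> \<le> r" for a
    using that by metis
  \<comment> \<open>The two signs eliminate the unknown offset of the centre.\<close>
  from this[of r] this[of "- r"] have "r \<le> t"
    using r by linarith
  then show ?thesis
    using s st by (simp add: field_simps)
qed

end

text \<open>On \<open>V\<close> the eigenvalues are \<open>2 + \<alpha> b / low A\<close>: the least
  is 1, and trace 0 provides some \<open>\<alpha> b >= 0\<close>, hence one that is at least
  2.\<close>

lemma (in subspace_proj) traceless_ellipsoid:
  assumes A: "traceless_on A" and "A \<noteq> 0"
  shows "low A > 0" "\<exists>E \<beta>. ellipsoid V E (2 *\<^sub>R P + inverse (low A) *\<^sub>R A) \<beta>"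
proof -
  obtain E \<alpha> where E: "orthonormal E" "span E = V" "card E = n" "\<And>b. b \<in> E \<Longrightarrow> A b = \<alpha> b *\<^sub>R b"
    "\<And>x. A x = (\<Sum>b\<in>E. (\<alpha> b * (x \<bullet> b)) *\<^sub>R b)" "sum \<alpha> E = 0"
    "\<forall>b\<in>E. - low A \<le> \<alpha> b" "\<exists>b\<in>E. \<alpha> b = - low A"
    using traceless_spectral[OF A] by blast
  have fin: "finite E"
    using E(1) by (rule orthonormal_finite)
  show low: "low A > 0"
  proof (rule ccontr)
    assume "\<not> low A > 0"
    then have "\<And>b. b \<in> E \<Longrightarrow> 0 \<le> \<alpha> b"
      using E(7) by force
    then have "\<forall>b\<in>E. \<alpha> b = 0"
      using sum_nonneg_eq_0_iff[OF fin, of \<alpha>] E(6) by blast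
    then have "A x = 0" for x
      by (simp add: E(5))
    then show False
      using \<open>A \<noteq> 0\<close> by (simp add: blinfun_eqI)
  qed
  have "\<exists>b\<in>E. \<alpha> b \<ge> 0"
  proof (rule ccontr)
    assume "\<not> ?thesis"
    then have "sum \<alpha> E < 0"
      using E(3) n fin sum_strict_mono[of E \<alpha> "\<lambda>_. 0"] by force
    then show False
      using E(6) by simp
  qed
  have "ellipsoid V E (2 *\<^sub>R P + inverse (low A) *\<^sub>R A) (\<lambda>b. 2 + \<alpha> b / low A)"
  proof
    fix b assume b: "b \<in> E"
    then have "b \<in> V"
      using E(2) span_base by blast
    then show "(2 *\<^sub>R P + inverse (low A) *\<^sub>R A) b = (2 + \<alpha> b / low A) *\<^sub>R b"
      using b by (simp add: blinfun.add_left blinfun.scaleR_left P_id E(4) scaleR_add_left divide_inverse mult.commute)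
    show "1 \<le> 2 + \<alpha> b / low A"
      using E(7) b low by (auto simp: field_simps)
  next
    show "\<exists>b\<in>E. 2 + \<alpha> b / low A = 1"
      using E(8) low by force
    show "\<exists>b\<in>E. 2 \<le> 2 + \<alpha> b / low A"
      using \<open>\<exists>b\<in>E. \<alpha> b \<ge> 0\<close> low by (meson divide_nonneg_pos le_add_same_cancel1)
  qed (use E in auto)
  then show "\<exists>E \<beta>. ellipsoid V E (2 *\<^sub>R P + inverse (low A) *\<^sub>R A) \<beta>"
    by blast
qed

section \<open>Continuity and distance to balls\<close>

text \<open>Positive dimension forces a finite basis, since \<open>card\<close> of an infinite set
  is 0.\<close>

lemma ex_orthonormal_basis:
  fixes V :: "'a::real_inner set"
  assumes "subspace V" "dim V > 0"
  obtains E where "orthonormal E" "span E = V" "card E = dim V"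
proof -
  obtain B where B: "B \<subseteq> V" "independent B" "V \<subseteq> span B" "card B = dim V"
    using basis_exists by blast
  then have "finite B" "span B = V"
    using assms card_gt_0_iff by (metis, metis span_subspace)
  then obtain E where "orthonormal E" "span E = V"
    using ex_orthonormal_span by metis
  then show ?thesis
    using that orthonormal_dim by metis
qed

section \<open>The gap of subspaces against the operator norm\<close>

lemma norm_orth_proj_le:
  assumes "orthonormal E" "span E = V"
  shows "norm (orth_proj V x) \<le> norm x"
proof -
  have "orth_proj V x \<bullet> orth_proj V x = x \<bullet> orth_proj V x"
    using orth_proj_inner[OF assms orth_proj_in[OF assms]] .
  also have "\<dots> \<le> norm x * norm (orth_proj V x)"
    by (rule norm_cauchy_schwarz)
  finally have "norm (orth_proj V x) * norm (orth_proj V x) \<le> norm x * norm (orth_proj V x)"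
    by (simp add: dot_square_norm power2_eq_square)
  then show ?thesis
    by (cases "orth_proj V x = 0") auto
qed

lemma orth_proj_nearest:
  assumes "orthonormal E" "span E = V" "y \<in> V"
  shows "norm (x - orth_proj V x) \<le> norm (x - y)"
proof -
  define z where "z = x - y"
  define p where "p = orth_proj V z"
  have "p \<bullet> p = z \<bullet> p"
    unfolding p_def by (rule orth_proj_inner[OF assms(1,2) orth_proj_in[OF assms(1,2)]])
  then have "orthogonal (z - p) p"
    by (simp add: orthogonal_def inner_diff_left)
  then have "(norm (z - p + p))\<^sup>2 = (norm (z - p))\<^sup>2 + (norm p)\<^sup>2"
    by (rule norm_add_Pythagorean)
  then have "(norm (z - p))\<^sup>2 \<le> (norm z)\<^sup>2"
    by simp
  then have "norm (z - p) \<le> norm z"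
    by (rule power2_le_imp_le) simp
  moreover have "z - p = x - orth_proj V x"
    by (simp add: z_def p_def blinfun.diff_right orth_proj_id[OF assms])
  ultimately show ?thesis
    unfolding z_def[symmetric] by simp
qed

lemma infdist_le_hausdorff_dist:
  assumes "bdd_above ((\<lambda>a. infdist a B) ` A)" "a \<in> A"
  shows "infdist a B \<le> hausdorff_dist A B"
  unfolding hausdorff_dist_def using cSUP_upper[OF assms(2,1)] by simp

lemma hausdorff_dist_commute: "hausdorff_dist A B = hausdorff_dist B A"
  by (simp add: hausdorff_dist_def max.commute)

lemma hausdorff_dist_leI:
  assumes "A \<noteq> {}" "B \<noteq> {}"
    and "\<And>a. a \<in> A \<Longrightarrow> \<exists>b\<in>B. dist a b \<le> c" "\<And>b. b \<in> B \<Longrightarrow> \<exists>a\<in>A. dist b a \<le> c"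
  shows "hausdorff_dist A B \<le> c"
  unfolding hausdorff_dist_def using assms
  by (intro max.boundedI cSUP_least) (meson infdist_le2)+

text \<open>Normalise \<open>x\<close>: some point of \<open>W\<close> is closer than
  \<open>\<eta>\<close>, and the projection is at least as close. Then scale back.\<close>

lemma hausdorff_unit_balls_less:
  fixes V W :: "'a::real_inner set"
  assumes W: "orthonormal E'" "span E' = W"
    and less: "hausdorff_dist (V \<inter> cball 0 1) (W \<inter> cball 0 1) < \<eta>" and x: "x \<in> V" "subspace V"
  shows "norm (x - orth_proj W x) \<le> \<eta> * norm x"
proof (cases "x = 0")
  case False
  let ?u = "x /\<^sub>R norm x"
  let ?B = "W \<inter> cball 0 1"
  have zero: "0 \<in> ?B"
    using W(2) span_zero by auto
  have "infdist a ?B \<le> 1" if "a \<in> V \<inter> cball 0 1" for a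
    using infdist_le2[OF zero, of a 1] that by simp
  then have "bdd_above ((\<lambda>a. infdist a ?B) ` (V \<inter> cball 0 1))"
    by (rule bdd_aboveI2)
  moreover have "?u \<in> V \<inter> cball 0 1"
    using x False by (simp add: subspace_scale)
  ultimately have "infdist ?u ?B < \<eta>"
    by (rule le_less_trans[OF infdist_le_hausdorff_dist less])
  then have "(INF y\<in>?B. dist ?u y) < \<eta>"
    using zero by (subst (asm) infdist_notempty) auto
  then obtain y where y: "y \<in> ?B" "dist ?u y < \<eta>"
    using zero by (subst (asm) cINF_less_iff) (auto intro: bdd_belowI2[of _ 0])
  have "norm (?u - orth_proj W ?u) \<le> \<eta>"
    using orth_proj_nearest[OF W, of y ?u] y by (simp add: dist_norm)
  moreover have "x - orth_proj W x = norm x *\<^sub>R (?u - orth_proj W ?u)"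
    using False by (simp add: blinfun.scaleR_right scaleR_diff_right)
  ultimately show ?thesis
    using mult_right_mono[of "norm (?u - orth_proj W ?u)" \<eta> "norm x"]
    by (simp only: norm_scaleR abs_norm_cancel) (simp add: mult.commute)
qed simp

text \<open>Write \<open>(Q - P) x = - (P x - Q (P x)) + Q z\<close> with
  \<open>z = x - P x\<close>. The first part is bounded directly. For the second,
  \<open>|Q z|^2\<close> is the inner product of \<open>z\<close> with \<open>Q z - P (Q z)\<close>,
  because \<open>z\<close> is orthogonal to \<open>V\<close>; this needs the same bound with
  \<open>V\<close> and \<open>W\<close> exchanged.\<close>

lemma norm_diff_orth_proj_le:
  fixes V W :: "'a::real_inner set"
  assumes V: "orthonormal E" "span E = V" and W: "orthonormal E'" "span E' = W"
    and less: "hausdorff_dist (V \<inter> cball 0 1) (W \<inter> cball 0 1) < \<eta>"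
  shows "norm (orth_proj W - orth_proj V) \<le> 2 * \<eta>"
proof (rule norm_blinfun_bound)
  let ?P = "orth_proj V" and ?Q = "orth_proj W"
  have sub: "subspace V" "subspace W"
    using V(2) W(2) subspace_span by blast+
  have "0 \<le> hausdorff_dist (V \<inter> cball 0 1) (W \<inter> cball 0 1)"
  proof -
    have "infdist 0 (W \<inter> cball 0 1) \<le> hausdorff_dist (V \<inter> cball 0 1) (W \<inter> cball 0 1)"
    proof (rule infdist_le_hausdorff_dist)
      have "infdist a (W \<inter> cball 0 1) \<le> 1" if "a \<in> V \<inter> cball 0 1" for a
        using infdist_le2[of 0 "W \<inter> cball 0 1" a 1] that sub by (simp add: subspace_0)
      then show "bdd_above ((\<lambda>a. infdist a (W \<inter> cball 0 1)) ` (V \<inter> cball 0 1))"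
        by (rule bdd_aboveI2)
    qed (simp add: sub subspace_0)
    then show ?thesis
      using infdist_nonneg order_trans by blast
  qed
  then have \<eta>: "\<eta> \<ge> 0"
    using less by linarith
  then show "0 \<le> 2 * \<eta>"
    by simp
  fix x
  let ?z = "x - ?P x"
  have z: "norm ?z \<le> norm x"
    using orth_proj_nearest[OF V subspace_0[OF sub(1)], of x] by simp
  have "norm (?P x - ?Q (?P x)) \<le> \<eta> * norm (?P x)"
    by (rule hausdorff_unit_balls_less[OF W less orth_proj_in[OF V] sub(1)])
  also have "\<dots> \<le> \<eta> * norm x"
    using \<eta> norm_orth_proj_le[OF V] by (intro mult_left_mono) auto
  finally have 1: "norm (?P x - ?Q (?P x)) \<le> \<eta> * norm x" .
  have Qz: "?Q ?z \<in> W"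
    by (rule orth_proj_in[OF W])
  have "norm (?Q ?z) * norm (?Q ?z) = ?Q ?z \<bullet> ?Q ?z"
    by (simp add: dot_square_norm power2_eq_square)
  also have "\<dots> = ?z \<bullet> ?Q ?z"
    by (rule orth_proj_inner[OF W Qz])
  also have "\<dots> = ?z \<bullet> (?Q ?z - ?P (?Q ?z))"
    using orth_proj_inner[OF V orth_proj_in[OF V], of x "?Q ?z"]
    by (simp add: inner_diff_left inner_diff_right)
  also have "\<dots> \<le> norm ?z * norm (?Q ?z - ?P (?Q ?z))"
    by (rule norm_cauchy_schwarz)
  also have "\<dots> \<le> norm x * (\<eta> * norm (?Q ?z))"
    using less z by (intro mult_mono hausdorff_unit_balls_less[OF V _ Qz sub(2)])
      (auto simp: hausdorff_dist_commute)
  finally have "norm (?Q ?z) \<le> \<eta> * norm x"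
    using \<eta> by (cases "?Q ?z = 0") (auto simp: mult.assoc mult.commute)
  moreover have "(?Q - ?P) x = - (?P x - ?Q (?P x)) + ?Q ?z"
    by (simp add: blinfun.diff_left blinfun.diff_right)
  ultimately show "norm ((?Q - ?P) x) \<le> 2 * \<eta> * norm x"
    using 1 norm_triangle_ineq[of "- (?P x - ?Q (?P x))" "?Q ?z"] by (simp only: norm_minus_cancel)
qed

text \<open>Match the image of \<open>x\<close> in \<open>V\<close> with the image of its projection
  to \<open>W\<close>, which is still in the unit ball.\<close>

lemma hausdorff_dist_image_unit_balls:
  fixes S T :: "'a::real_inner \<Rightarrow>\<^sub>L 'a"
  assumes V: "orthonormal E" "span E = V" and W: "orthonormal E'" "span E' = W"
  shows "hausdorff_dist (S ` (V \<inter> cball 0 1)) (T ` (W \<inter> cball 0 1))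
           \<le> norm ((S o\<^sub>L orth_proj V) - (T o\<^sub>L orth_proj W))"
proof -
  have half: "\<exists>b\<in>T ` (W \<inter> cball 0 1). dist a b \<le> norm ((S o\<^sub>L orth_proj V) - (T o\<^sub>L orth_proj W))"
    if "orthonormal E" "span E = V" "orthonormal E'" "span E' = W" and a: "a \<in> S ` (V \<inter> cball 0 1)"
    for E E' V W :: "'a set" and S T :: "'a \<Rightarrow>\<^sub>L 'a" and a
  proof -
    obtain x where x: "x \<in> V" "norm x \<le> 1" "a = S x"
      using a by auto
    let ?y = "orth_proj W x"
    have "?y \<in> W \<inter> cball 0 1"
      using orth_proj_in[OF that(3,4)] norm_orth_proj_le[OF that(3,4), of x] x by simp
    moreover have "dist a (T ?y) = norm (((S o\<^sub>L orth_proj V) - (T o\<^sub>L orth_proj W)) x)"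
      using x orth_proj_id[OF that(1,2) x(1)] by (simp add: dist_norm blinfun.diff_left)
    then have "dist a (T ?y) \<le> norm ((S o\<^sub>L orth_proj V) - (T o\<^sub>L orth_proj W)) * norm x"
      by (simp add: norm_blinfun)
    then have "dist a (T ?y) \<le> norm ((S o\<^sub>L orth_proj V) - (T o\<^sub>L orth_proj W))"
      using x(2) by (meson mult_left_le norm_ge_zero order_trans)
    ultimately show ?thesis
      by blast
  qed
  have "0 \<in> V \<inter> cball 0 1" "0 \<in> W \<inter> cball 0 1"
    using V(2) W(2) span_zero by auto
  then show ?thesis
    using half[OF V W, of _ S T] half[OF W V, of _ T S]
    by (intro hausdorff_dist_leI) (auto simp: norm_minus_commute)
qed

text \<open>\<open>ball_ratio\<close> bounds every member of the set. The infimum of an empty set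
  would say nothing, so an admissible pair is exhibited first, and there it matters that 0 is
  interior to \<open>D\<close>.\<close>

lemma (in ellipsoid) body_dist_ball_ge:
  fixes D :: "'a set"
  assumes D: "D = cball c r \<inter> V" "c \<in> V" "r > 0" and zero: "0 \<in> (top_of_set V) interior_of D"
  shows "ln 2 \<le> Inf {ln (t / s) | s t. 0 < s \<and> 0 < t \<and> (*\<^sub>R) s ` B \<subseteq> D \<and> D \<subseteq> (*\<^sub>R) t ` B}"
    (is "_ \<le> Inf ?X")
proof (rule cInf_greatest)
  obtain U where U: "open U" "0 \<in> U" "V \<inter> U \<subseteq> D"
    using zero by (auto simp: interior_of_def openin_open)
  then obtain \<epsilon> where \<epsilon>: "\<epsilon> > 0" "ball 0 \<epsilon> \<subseteq> U"
    using openE by blast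
  obtain R where R: "R > 0" "\<And>y. y \<in> B \<Longrightarrow> norm y \<le> R"
    using compact_imp_bounded[OF compact_body] bounded_pos by metis
  \<comment> \<open>\<open>s\<close> shrinks the body into \<open>ball 0 \<epsilon>\<close>;
    \<open>t\<close> works because \<open>D\<close> lies in the ball of radius
    \<open>norm c + r\<close> about 0 and the body contains the unit ball of
    \<open>V\<close>.\<close>
  define s where "s = \<epsilon> / (2 * R)"
  define t where "t = norm c + r"
  have s: "s > 0" and t: "t > 0"
    using \<epsilon> R D by (auto simp: s_def t_def add_nonneg_pos)
  have "s *\<^sub>R y \<in> D" if y: "y \<in> B" for y
  proof -
    have "norm (s *\<^sub>R y) \<le> s * R"
      using R(2)[OF y] s by simp
    also have "\<dots> < \<epsilon>"
      using R \<epsilon> by (simp add: s_def)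
    finally have "s *\<^sub>R y \<in> U"
      using \<epsilon> by auto
    moreover have "s *\<^sub>R y \<in> V"
      using y body_subset subspace_scale[OF subspace_V] by blast
    ultimately show ?thesis
      using U by blast
  qed
  then have "(*\<^sub>R) s ` B \<subseteq> D"
    by blast
  moreover have "D \<subseteq> (*\<^sub>R) t ` B"
  proof
    fix x assume x: "x \<in> D"
    then have "norm x \<le> t"
      using norm_triangle_sub[of x c] D by (simp add: t_def dist_norm norm_minus_commute)
    then have "x /\<^sub>R t \<in> V \<inter> cball 0 1"
      using x D t by (simp add: subspace_scale[OF subspace_V] field_simps)
    then have "x /\<^sub>R t \<in> B"
      using cball_subset_body by blast
    moreover have "x = t *\<^sub>R (x /\<^sub>R t)"
      using t by simp
    ultimately show "x \<in> (*\<^sub>R) t ` B"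
      by (rule rev_image_eqI)
  qed
  ultimately show "?X \<noteq> {}"
    using s t by blast
next
  fix z assume "z \<in> ?X"
  then obtain s t where "z = ln (t / s)" "0 < s" "0 < t" "(*\<^sub>R) s ` B \<subseteq> D" "D \<subseteq> (*\<^sub>R) t ` B"
    by blast
  then show "ln 2 \<le> z"
    using ball_ratio[OF D(2,3), of s t] D(1) by simp
qed

section \<open>The family over the whole Grassmannian\<close>

theorem theorem2:
  fixes n :: nat
  assumes "n \<ge> 3" and "odd n"
  shows "\<exists>\<delta>::real. \<delta> > 0 \<and> (\<forall>N::nat. N \<ge> n \<longrightarrow>
           (\<exists>B. continuous_family n N B \<and>
                (\<forall>V\<in>Grassmannian n N. convex_body V (B V) \<and> symmetric (B V)) \<and>
                (\<forall>V\<in>Grassmannian n N. \<forall>D.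
                   euclidean_ball V D \<and> 0 \<in> (top_of_set V) interior_of D \<longrightarrow>
                   body_dist (B V) D > \<delta>)))"
proof (intro exI[of _ "ln 2 / 2"] conjI allI impI)
  \<comment> \<open>The bodies have distance at least \<open>ln 2\<close> from every admissible
    ball; halving makes the inequality strict.\<close>
  show "(0::real) < ln 2 / 2"
    by simp
  fix N :: nat assume N: "N \<ge> n"
  obtain F where F: "orthonormal F" "span F = Rn N"
    using ex_orthonormal_basis[OF subspace_Rn, of N] N assms(1) by (auto simp: dim_Rn)
  \<comment> \<open>All \<open>n\<close>-tuples from the basis: finitely many charts, and together
    they cover the Grassmannian.\<close>
  obtain charts where charts: "set charts = {vs. set vs \<subseteq> F \<and> length vs = n}"
    using finite_list[OF finite_lists_length_eq[OF orthonormal_finite[OF F(1)]]] by metis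
  define cs where "cs = map (chart n) charts"
  define A where "A = iterate_step F n cs"
  define T where "T P = 2 *\<^sub>R P + inverse (low (A P)) *\<^sub>R A P" for P
  define B where "B V = T (orth_proj V) ` (V \<inter> cball 0 1)" for V
  let ?\<Pi> = "orth_proj ` Grassmannian n N"
  have basis: "\<exists>E. orthonormal E \<and> span E = V \<and> card E = n" if "V \<in> Grassmannian n N" for V
    using ex_orthonormal_basis[of V] that assms(1) unfolding Grassmannian_def by force
  have main: "low (A (orth_proj V)) > 0 \<and> (\<exists>E \<beta>. ellipsoid V E (T (orth_proj V)) \<beta>)"
    if V: "V \<in> Grassmannian n N" for V
  proof -
    obtain E where E: "orthonormal E" "span E = V" "card E = n"
      using basis[OF V] by blast
    interpret subspace_proj V E F n "orth_proj V"
      using E F V assms(1) by unfold_locales (auto simp: Grassmannian_def)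
    have skew: "skewadjoint (snd c)" if "c \<in> set cs" for c
      using that chart_skew[OF assms(2)] by (auto simp: cs_def)
    have "\<exists>c\<in>set cs. regularity (orth_proj V) (orth_proj V (fst c)) (snd c) > 0"
      using ex_regular_chart[OF assms(2)] charts by (auto simp: cs_def)
    then have "A (orth_proj V) \<noteq> 0"
      unfolding A_def using iterate_step_nonzero[OF skew] by blast
    then show ?thesis
      using traceless_ellipsoid[OF iterate_step_traceless[OF skew]] unfolding A_def T_def by blast
  qed
  \<comment> \<open>Composed with \<open>P\<close>, these are the operators whose norm distance
    bounds the Hausdorff distance of the bodies; dividing by \<open>low\<close> is continuous
    because the field has no zeros.\<close>
  have contT: "continuous_on ?\<Pi> (\<lambda>P. T P o\<^sub>L P)"
  proof -
    have A: "continuous_on ?\<Pi> A"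
      unfolding A_def by (rule continuous_on_iterate_step)
    have "continuous_on ?\<Pi> (\<lambda>P. inverse (low (A P)))"
      using main by (intro continuous_on_inverse continuous_on_low A) fastforce
    then show ?thesis
      unfolding T_def
      by (intro continuous_on_blinfun_compose continuous_on_add continuous_on_scaleR A
          continuous_on_const continuous_on_id)
  qed
  have body: "convex_body V (B V) \<and> symmetric (B V) \<and> B V \<noteq> {}
      \<and> (\<forall>D. euclidean_ball V D \<and> 0 \<in> (top_of_set V) interior_of D \<longrightarrow> ln 2 \<le> body_dist (B V) D)"
    if V: "V \<in> Grassmannian n N" for V
  proof -
    obtain E \<beta> where "ellipsoid V E (T (orth_proj V)) \<beta>"
      using main[OF V] by blast
    then interpret ellipsoid V E "T (orth_proj V)" \<beta> .
    have "openin (top_of_set V) (V \<inter> ball 0 1)"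
      by (simp add: openin_open_Int)
    moreover have "0 \<in> V \<inter> ball 0 1" "V \<inter> ball 0 1 \<subseteq> B V"
      using cball_subset_body subspace_0[OF subspace_V] unfolding B_def by auto
    ultimately have "0 \<in> (top_of_set V) interior_of B V"
      unfolding interior_of_def by blast
    moreover have "B V \<noteq> {}"
      using subspace_0[OF subspace_V] by (auto simp: B_def)
    ultimately show ?thesis
      using body_subset compact_body convex_body_set uminus_body body_dist_ball_ge
      unfolding convex_body_def symmetric_def B_def euclidean_ball_def body_dist_def by blast
  qed
  show "\<exists>B. continuous_family n N B \<and>
        (\<forall>V\<in>Grassmannian n N. convex_body V (B V) \<and> symmetric (B V)) \<and>
        (\<forall>V\<in>Grassmannian n N. \<forall>D.
           euclidean_ball V D \<and> 0 \<in> (top_of_set V) interior_of D \<longrightarrow> body_dist (B V) D > ln 2 / 2)"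
  proof (intro exI[of _ B] conjI ballI allI impI)
    show "continuous_family n N B"
      unfolding continuous_family_def
    proof (intro conjI ballI allI impI)
      fix V :: "seq set" and \<epsilon> :: real
      assume V: "V \<in> Grassmannian n N" and "\<epsilon> > 0"
      then obtain d where d: "d > 0"
        "\<And>P. P \<in> ?\<Pi> \<Longrightarrow> dist P (orth_proj V) < d \<Longrightarrow>
           dist (T P o\<^sub>L P) (T (orth_proj V) o\<^sub>L orth_proj V) < \<epsilon>"
        using contT unfolding continuous_on_iff by blast
      \<comment> \<open>\<open>norm_diff_orth_proj_le\<close> doubles the gap, so
        \<open>d / 3\<close> leaves \<open>2 d / 3 < d\<close>.\<close>
      have "hausdorff_dist (B V) (B W) < \<epsilon>" if W: "W \<in> Grassmannian n N" "gap_dist V W < d / 3" for W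
      proof -
        obtain E E' where E: "orthonormal E" "span E = V" and E': "orthonormal E'" "span E' = W"
          using basis V W(1) by metis
        have "norm (orth_proj W - orth_proj V) \<le> 2 * (d / 3)"
          using W(2) unfolding gap_dist_def by (rule norm_diff_orth_proj_le[OF E E'])
        then have "dist (orth_proj W) (orth_proj V) < d"
          using d(1) by (simp add: dist_norm)
        then have "dist (T (orth_proj W) o\<^sub>L orth_proj W) (T (orth_proj V) o\<^sub>L orth_proj V) < \<epsilon>"
          using W(1) by (intro d(2)) auto
        then show ?thesis
          using hausdorff_dist_image_unit_balls[OF E E', of "T (orth_proj V)" "T (orth_proj W)"]
          unfolding B_def by (simp add: dist_norm norm_minus_commute)
      qed
      then show "\<exists>\<eta>>0. \<forall>W\<in>Grassmannian n N. gap_dist V W < \<eta> \<longrightarrow> hausdorff_dist (B V) (B W) < \<epsilon>"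
        using d(1) by (intro exI[of _ "d / 3"]) auto
    qed (use body in \<open>auto simp: convex_body_def\<close>)
  next
    fix V :: "seq set" and D
    assume "V \<in> Grassmannian n N" "euclidean_ball V D \<and> 0 \<in> (top_of_set V) interior_of D"
    then have "ln 2 \<le> body_dist (B V) D"
      using body by blast
    moreover have "ln 2 / 2 < (ln 2 :: real)"
      by simp
    ultimately show "ln 2 / 2 < body_dist (B V) D"
      by linarith
  qed (use body in auto)
qed

end
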